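(* For every $n\ge1$, the map $$\Delta=\Phi^{-1}\circ\mathcal{R}\circ\mathrm{DE}\circ\Psi$$ is a bijection from the set of EW-tableaux of size $n$ to the set of Le-tableaux of size $n$. Moreover, the shape of an EW-tableau $\mathcal{E}$ is obtained from the shape of the Le-tableau $\Delta(\mathcal{E})$ by adding to its left border a column of the same length as that border (empty rows included).
   Context: A Ferrers diagram is a left-aligned array of cells whose row lengths weakly decrease from top to bottom. EW-tableau: a 0/1-filling of a Ferrers diagram with nonempty rows such that (1) the top row has a 1 in every cell; (2) every other row has at least one 0; (3) no four cells forming the corners of a rectangle have 0s in two diagonally opposite corners and 1s in the other two. Its size is (number of rows) + (number of columns) $-1$. Le-tableau: a 0/1-filling of a Ferrers diagram, some of whose bottommost rows may be empty, such that (1) every column has a 1 in some cell; (2) if a cell has a 1 above it in the same column and a 1 to its left in the same row then it contains a 1. Its size is (number of rows) + (number of columns), empty rows included. Labels: number the unit steps of the southeast border, from the northeast corner to the southwest corner, by $0,1,\dots,n$ for an EW-tableau of size $n$, and by $1,\dots,n$ for a Le-tableau of size $n$; the vertical step at the right end of a row is that row's label (an empty row also has a vertical step), and the horizontal step at the bottom of a column is that column's label. The map $\Psi$ from EW-tableaux of size $n$ to permutations of $\{1,\dots,n\}$: delete all entries of the top row and disregard the label 0. Repeat until all labels have been read: (i) write down the labels of all unread columns containing no 1s, from right to left, and delete the entries of these columns; (ii) write down the labels of all unread rows containing no 0s, from bottom to top, and delete the entries of these rows. $\mathrm{DE}:\mathcal{S}_n\to\mathcal{S}_n$: for $\pi=a_1\dots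 a_n$ put $a_0=0$ and $\mathrm{DE}(\pi)=b_1\dots b_n$, where for each $1\le i\le n$: if $a_i>a_j$ for some $j>i$ then $b_{a_{i+1}}=a_i$; otherwise let $a_k$ ($0\le k<i$) be the rightmost letter smaller than $a_i$ and set $b_{a_{k+1}}=a_i$. This is a bijection. $\mathcal{R}$ is the cyclic right shift $a_1a_2\dots a_n\mapsto a_na_1a_2\dots a_{n-1}$. $\Phi$ is the known (Postnikov; Steingr\'imsson–Williams) bijection from Le-tableaux of size $n$ to permutations of $\{1,\dots,n\}$: copy the label of each row also to its left end and the label of each column also to its top end. From label $\ell$ on the left or top border, enter the tableau (heading right from a row label, down from a column label) and move straight through 0s; at each 1, turn to head right if heading down, and to head down if heading right. The label on the southeast border at which the path exits is the letter in place $\ell$ of $\Phi(\mathcal{L})$ (for an empty row $\ell$ the path exits immediately at $\ell$). *)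

theory Defs
  imports Main "HOL-Library.While_Combinator"
begin

text \<open>
  A 0/1-filling of a left-aligned array of cells is the list of its rows, from top to bottom;
  each row is listed from left to right, and \<open>True\<close> stands for the entry 1. Rows and
  columns are indexed from 0. An empty row is the entry \<open>[]\<close> of the list.
\<close>

type_synonym tableau = "bool list list"

definition shape :: "tableau \<Rightarrow> nat list" where
  "shape t = map length t"

definition ferrers :: "tableau \<Rightarrow> bool" where
  "ferrers t \<longleftrightarrow> sorted_wrt (\<ge>) (shape t)"

definition row_len :: "tableau \<Rightarrow> nat \<Rightarrow> nat" where
  "row_len t i = (if i < length t then length (t ! i) else 0)"

definition cell :: "tableau \<Rightarrow> nat \<Rightarrow> nat \<Rightarrow> bool" where
  "cell t i j \<longleftrightarrow> i < length t \<and> j < row_len t i"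

definition nrows :: "tableau \<Rightarrow> nat" where
  "nrows t = length t"

text \<open>In a Ferrers diagram the top row is the longest one.\<close>

definition ncols :: "tableau \<Rightarrow> nat" where
  "ncols t = row_len t 0"


subsection \<open>EW-tableaux and Le-tableaux\<close>

definition ew_tableau :: "tableau \<Rightarrow> bool" where
  "ew_tableau t \<longleftrightarrow>
     t \<noteq> [] \<and> ferrers t \<and> (\<forall>r \<in> set t. r \<noteq> []) \<and>
     (\<forall>j. cell t 0 j \<longrightarrow> t ! 0 ! j) \<and>
     (\<forall>i. 0 < i \<and> i < nrows t \<longrightarrow> (\<exists>j. cell t i j \<and> \<not> t ! i ! j)) \<and>
     \<not> (\<exists>i i' j j'. i < i' \<and> j < j' \<and>
          cell t i j \<and> cell t i j' \<and> cell t i' j \<and> cell t i' j' \<and>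
          (\<not> t ! i ! j \<and> \<not> t ! i' ! j' \<and> t ! i ! j' \<and> t ! i' ! j \<or>
           t ! i ! j \<and> t ! i' ! j' \<and> \<not> t ! i ! j' \<and> \<not> t ! i' ! j))"

definition EW :: "nat \<Rightarrow> tableau set" where
  "EW n = {t. ew_tableau t \<and> nrows t + ncols t - 1 = n}"

definition le_tableau :: "tableau \<Rightarrow> bool" where
  "le_tableau t \<longleftrightarrow>
     ferrers t \<and>
     (\<forall>j < ncols t. \<exists>i. cell t i j \<and> t ! i ! j) \<and>
     (\<forall>i j. cell t i j \<and> (\<exists>i' < i. t ! i' ! j) \<and> (\<exists>j' < j. t ! i ! j') \<longrightarrow> t ! i ! j)"

definition Le :: "nat \<Rightarrow> tableau set" where
  "Le n = {t. le_tableau t \<and> nrows t + ncols t = n}"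


subsection \<open>The southeast border and its labels\<close>

text \<open>
  A unit step of the southeast border is the right end of a row or the bottom of a column.
  Going from the northeast to the southwest corner, the vertical step of row \<open>i\<close> is followed
  by the horizontal steps of those columns, from right to left, that end in row \<open>i\<close>.
\<close>

datatype line = Row nat | Col nat

definition border :: "tableau \<Rightarrow> line list" where
  "border t =
     concat (map (\<lambda>i. Row i # map Col (rev [row_len t (Suc i)..<row_len t i])) [0..<nrows t])"

text \<open>The number of border steps preceding the given one.\<close>

definition ew_label :: "tableau \<Rightarrow> line \<Rightarrow> nat" where
  "ew_label t s = length (takeWhile (\<lambda>x. x \<noteq> s) (border t))"

definition le_label :: "tableau \<Rightarrow> line \<Rightarrow> nat" where
  "le_label t s = Suc (ew_label t s)"


subsection \<open>The map \<open>\<Psi>\<close>\<close>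

text \<open>
  A state consists of the unread rows, from bottom to top, the unread columns, from right to
  left, and the word written so far. The entries not yet deleted are those that lie both in an
  unread row and in an unread column.
\<close>

type_synonym psi_state = "nat list \<times> nat list \<times> nat list"

definition psi_columns :: "tableau \<Rightarrow> psi_state \<Rightarrow> psi_state" where
  "psi_columns t = (\<lambda>(rs, cs, w).
     let no_ones = (\<lambda>j. \<forall>i \<in> set rs. cell t i j \<longrightarrow> \<not> t ! i ! j)
     in (rs, filter (\<lambda>j. \<not> no_ones j) cs,
         w @ map (\<lambda>j. ew_label t (Col j)) (filter no_ones cs)))"

definition psi_rows :: "tableau \<Rightarrow> psi_state \<Rightarrow> psi_state" where
  "psi_rows t = (\<lambda>(rs, cs, w).
     let no_zeros = (\<lambda>i. \<forall>j \<in> set cs. cell t i j \<longrightarrow> t ! i ! j)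
     in (filter (\<lambda>i. \<not> no_zeros i) rs, cs,
         w @ map (\<lambda>i. ew_label t (Row i)) (filter no_zeros rs)))"

definition Psi :: "tableau \<Rightarrow> nat list" where
  "Psi t =
     (case while (\<lambda>(rs, cs, w). rs \<noteq> [] \<or> cs \<noteq> []) (psi_rows t \<circ> psi_columns t)
             (rev [1..<nrows t], rev [0..<ncols t], [])
      of (rs, cs, w) \<Rightarrow> w)"


subsection \<open>The maps \<open>DE\<close> and \<open>\<R>\<close> on permutations written as words\<close>

text \<open>
  With \<open>a = 0 # w\<close>, the letter \<open>a\<^sub>i\<close> of the word \<open>w\<close> is \<open>a ! i\<close>, for \<open>0 \<le> i \<le> length w\<close>.
\<close>

definition DE_place :: "nat list \<Rightarrow> nat \<Rightarrow> nat" where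
  "DE_place w i =
     (let a = 0 # w in
      if \<exists>j \<in> {i<..length w}. a ! i > a ! j then a ! (i + 1)
      else a ! (Max {k \<in> {..<i}. a ! k < a ! i} + 1))"

text \<open>
  The letter \<open>b\<^sub>p\<close> has list index \<open>p - 1\<close>. When \<open>w\<close> is a permutation, \<open>DE_place w\<close> permutes the
  places, so that every initial entry 0 gets overwritten exactly once.
\<close>

definition DE :: "nat list \<Rightarrow> nat list" where
  "DE w = fold (\<lambda>i b. b[DE_place w i - 1 := (0 # w) ! i]) [1..<Suc (length w)]
            (replicate (length w) 0)"

definition cyclic_shift :: "nat list \<Rightarrow> nat list" where
  "cyclic_shift w = last w # butlast w"


subsection \<open>The map \<open>\<Phi>\<close>\<close>

datatype heading = Rightward | Downward

fun turn :: "heading \<Rightarrow> heading" where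
  "turn Rightward = Downward"
| "turn Downward = Rightward"

text \<open>The border step at which the path exits that is about to visit position \<open>(i, j)\<close>.\<close>

function exit_step :: "tableau \<Rightarrow> heading \<Rightarrow> nat \<Rightarrow> nat \<Rightarrow> line" where
  "exit_step t h i j =
     (if cell t i j then
        (case (if t ! i ! j then turn h else h) of
           Rightward \<Rightarrow> exit_step t Rightward i (Suc j)
         | Downward \<Rightarrow> exit_step t Downward (Suc i) j)
      else (case h of Rightward \<Rightarrow> Row i | Downward \<Rightarrow> Col j))"
  by pat_completeness auto

lemma cell_bounds: "cell t i j \<Longrightarrow> i < length t \<and> j < sum_list (map length t)"
  using member_le_sum_list[of "length (t ! i)" "map length t"]
  by (auto simp: cell_def row_len_def)

termination
  by (relation "measure (\<lambda>(t, h, i, j). (length t - i) + (sum_list (map length t) - j))")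
     (auto dest!: cell_bounds)

declare exit_step.simps [simp del]

fun path_exit :: "tableau \<Rightarrow> line \<Rightarrow> line" where
  "path_exit t (Row i) = exit_step t Rightward i 0"
| "path_exit t (Col j) = exit_step t Downward 0 j"

text \<open>The step \<open>border t ! (\<ell> - 1)\<close> of a Le-tableau \<open>t\<close> has the label \<open>\<ell>\<close>.\<close>

definition Phi :: "tableau \<Rightarrow> nat list" where
  "Phi t = map (\<lambda>s. le_label t (path_exit t s)) (border t)"


definition Delta :: "nat \<Rightarrow> tableau \<Rightarrow> tableau" where
  "Delta n = inv_into (Le n) Phi \<circ> cyclic_shift \<circ> DE \<circ> Psi"

text \<open>
  The shape with a new column at the left border, containing one cell for each row, empty rows
  included.
\<close>

definition add_left_column :: "nat list \<Rightarrow> nat list" where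
  "add_left_column s = map Suc s"

end

theory Submission
  imports Defs "HOL-Combinatorics.Multiset_Permutations"
begin

text \<open>
  Each of the four maps is a bijection onto or between permutations of \<open>{1..n}\<close>, and each carries the
  row labels along in a recognizable form, so that the shapes can be compared at the end.

  \<^emph>\<open>EW-tableaux.\<close> An entry 1 says that its row is read before its column, an entry 0 that its
  column is read before its row. The word \<open>\<Psi> E\<close> therefore records all entries, and its descent bottoms
  (the letters with a larger left neighbour) are the row labels other than 0: \<open>reads E w\<close> states these
  two properties of a word \<open>w\<close>. The algorithm never gets stuck because a Ferrers filling
  without forbidden rectangle has no alternating cycle (\<open>alternating_cycle_free\<close>). A word \<open>w\<close> is
  determined by its descent bottoms together with the relative order of each descent bottom
  and each larger letter that is not one (\<open>descends_into_unique\<close>). Conversely, every word determines an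
  EW-tableau by the same two rules (\<open>reads_exists\<close>). Hence \<open>\<Psi>\<close> is a bijection.

  \<^emph>\<open>The map DE.\<close> A prefix of \<open>w\<close> and the permutation \<open>DE w\<close> determine the next letter of \<open>w\<close>
  (\<open>DE_next_letter\<close>), so DE is injective. It turns descent bottoms into excedances
  (\<open>DE_excedance_iff\<close>), which the cyclic shift moves one place to the right.

  \<^emph>\<open>Le-tableaux.\<close> A Le-tableau of size \<open>n + 1\<close> arises from one of size \<open>n\<close> by adding either an empty
  bottom row or a left column whose entries 1 form a nonempty set of \<^emph>\<open>unrestricted\<close> rows, those
  having no 0 below a 1. Under \<open>\<Phi>\<close> the unrestricted rows are the left-to-right maxima of the
  word. An empty row appends the letter \<open>n + 1\<close>; a column moves the values of the chosen maxima
  to the left, the first one to the new last place, while the last place chosen receives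
  \<open>n + 1\<close> (\<open>push\<close>). The chosen maxima can be recovered from the result, where they are
  the left-to-right maxima exceeding the last letter (\<open>pull\<close>). So \<open>\<Phi>\<close> is a bijection, and the same
  induction shows that the rows are the weak excedances.

  \<^emph>\<open>Shapes.\<close> The labels of the rows of \<open>E\<close> other than the top row are the excedances of \<open>DE (\<Psi> E)\<close>, so the rows
  of \<open>E\<close> are the weak excedances of the cyclic shift, which are the rows of \<open>\<Delta> E\<close>. The border
  of \<open>E\<close> is thus that of \<open>\<Delta> E\<close> followed by one horizontal step.
\<close>

section \<open>Positions in lists\<close>

definition pos :: "'a list \<Rightarrow> 'a \<Rightarrow> nat" where
  "pos xs x = length (takeWhile (\<lambda>y. y \<noteq> x) xs)"

lemma pos_Nil [simp]: "pos [] x = 0"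
  by (simp add: pos_def)

lemma pos_Cons [simp]: "pos (y # xs) x = (if y = x then 0 else Suc (pos xs x))"
  by (simp add: pos_def)

lemma pos_append: "pos (xs @ ys) x = (if x \<in> set xs then pos xs x else length xs + pos ys x)"
  by (induction xs) auto

lemma pos_less_length [simp]: "pos xs x < length xs \<longleftrightarrow> x \<in> set xs"
  by (induction xs) auto

lemma nth_pos [simp]: "x \<in> set xs \<Longrightarrow> xs ! pos xs x = x"
  by (induction xs) auto

lemma pos_nth [simp]: "distinct xs \<Longrightarrow> i < length xs \<Longrightarrow> pos xs (xs ! i) = i"
  by (induction xs arbitrary: i) (auto simp: nth_Cons split: nat.splits)

lemma pos_map_inj: "inj f \<Longrightarrow> pos (map f xs) (f x) = pos xs x"
  by (induction xs) (auto simp: inj_eq)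

lemma pos_inject: "x \<in> set xs \<Longrightarrow> y \<in> set xs \<Longrightarrow> pos xs x = pos xs y \<longleftrightarrow> x = y"
  by (metis nth_pos)

lemma ew_label_pos: "ew_label t s = pos (border t) s"
  by (simp add: ew_label_def pos_def)


section \<open>The southeast border\<close>

text \<open>
  Every Ferrers diagram is built from the empty one by adding empty bottom rows and full left
  columns. Both operations extend the border at its southwest end, so the labels of
  the old steps persist; this is what makes them fit for inductions about labels.
\<close>

definition add_column :: "bool list \<Rightarrow> tableau \<Rightarrow> tableau" where
  "add_column c t = map2 (#) c t"

lemma length_add_column [simp]: "length c = length t \<Longrightarrow> length (add_column c t) = length t"
  by (simp add: add_column_def)

lemma nth_add_column [simp]:
  "length c = length t \<Longrightarrow> i < length t \<Longrightarrow> add_column c t ! i = c ! i # t ! i"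
  by (simp add: add_column_def)

lemma shape_add_column: "length c = length t \<Longrightarrow> shape (add_column c t) = map Suc (shape t)"
  by (rule nth_equalityI) (auto simp: shape_def)

lemma row_len_add_column:
  "length c = length t \<Longrightarrow> row_len (add_column c t) i = (if i < length t then Suc (row_len t i) else 0)"
  by (simp add: row_len_def)

lemma row_len_add_row [simp]: "row_len (t @ [[]]) i = row_len t i"
  by (simp add: row_len_def nth_append)

lemma ncols_add_column:
  "length c = length t \<Longrightarrow> t \<noteq> [] \<Longrightarrow> ncols (add_column c t) = Suc (ncols t)"
  by (simp add: ncols_def row_len_add_column)

lemma ncols_add_row [simp]: "ncols (t @ [[]]) = ncols t"
  by (simp add: ncols_def)

lemma nrows_add_column [simp]: "length c = length t \<Longrightarrow> nrows (add_column c t) = nrows t"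
  by (simp add: nrows_def)

lemma nrows_add_row [simp]: "nrows (t @ [[]]) = Suc (nrows t)"
  by (simp add: nrows_def)

lemma ferrers_add_row [simp]: "ferrers (t @ [[]]) \<longleftrightarrow> ferrers t"
  by (auto simp: ferrers_def shape_def sorted_wrt_append)

lemma ferrers_add_column [simp]: "length c = length t \<Longrightarrow> ferrers (add_column c t) \<longleftrightarrow> ferrers t"
  by (simp add: ferrers_def shape_add_column sorted_wrt_map)

lemma row_len_antimono: "ferrers t \<Longrightarrow> i \<le> i' \<Longrightarrow> row_len t i' \<le> row_len t i"
  by (cases "i = i'")
    (auto simp: ferrers_def shape_def row_len_def sorted_wrt_iff_nth_less)

lemma ferrers_cases:
  assumes "ferrers t"
  obtains (Nil) "t = []"
    | (row) t' where "ferrers t'" "t = t' @ [[]]"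
    | (column) c t' where "ferrers t'" "t' \<noteq> []" "length c = length t'" "t = add_column c t'"
proof (cases "t = []")
  case False
  show ?thesis
  proof (cases "last t = []")
    case True
    then have "t = butlast t @ [[]]"
      using False by (metis append_butlast_last_id)
    then show ?thesis
      using row assms by (metis ferrers_add_row)
  next
    case nonempty: False
    have "t ! i \<noteq> []" if "i < length t" for i
    proof -
      have "row_len t (length t - 1) \<le> row_len t i"
        using assms that by (intro row_len_antimono) auto
      then show ?thesis
        using nonempty False that by (auto simp: row_len_def last_conv_nth)
    qed
    then have eq: "t = add_column (map hd t) (map tl t)"
      by (intro nth_equalityI) auto
    then have "ferrers (map tl t)"
      using assms by (metis ferrers_add_column length_map)
    then show ?thesis
      using column[of "map tl t" "map hd t"] eq False by simp
  qed
qed (use Nil in auto)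

lemma ferrers_induct [consumes 1, case_names Nil row column]:
  assumes "ferrers t"
    and "P []"
    and "\<And>t. ferrers t \<Longrightarrow> P t \<Longrightarrow> P (t @ [[]])"
    and "\<And>c t. ferrers t \<Longrightarrow> t \<noteq> [] \<Longrightarrow> length c = length t \<Longrightarrow> P t \<Longrightarrow> P (add_column c t)"
  shows "P t"
  using assms(1)
proof (induction "nrows t + ncols t" arbitrary: t rule: less_induct)
  case less
  from less.prems show ?case
  proof (cases rule: ferrers_cases)
    case (row t')
    then show ?thesis using less.hyps assms(3) by simp
  next
    case (column c t')
    then show ?thesis using less.hyps assms(4) by (simp add: ncols_add_column)
  qed (use assms(2) in simp)
qed

fun move_right :: "line \<Rightarrow> line" where
  "move_right (Row i) = Row i"
| "move_right (Col j) = Col (Suc j)"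

lemma inj_move_right: "inj move_right"
proof (rule injI)
  show "x = y" if "move_right x = move_right y" for x y
    using that by (cases x; cases y) auto
qed

lemma border_add_row: "border (t @ [[]]) = border t @ [Row (length t)]"
proof -
  have "row_len t (length t) = 0" "row_len t (Suc (length t)) = 0"
    by (simp_all add: row_len_def)
  then show ?thesis
    by (simp add: border_def nrows_def)
qed

lemma rev_upt_Suc_shift: "rev [Suc a..<Suc b] = map Suc (rev [a..<b])"
  by (simp only: rev_map [symmetric] map_Suc_upt)

lemma border_add_column:
  assumes "length c = length t" "t \<noteq> []"
  shows "border (add_column c t) = map move_right (border t) @ [Col 0]"
proof -
  obtain k where k: "length t = Suc k"
    using assms by (cases t) auto
  let ?T = "add_column c t"
  let ?step = "\<lambda>t i. Row i # map Col (rev [row_len t (Suc i)..<row_len t i])"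
  have upper: "?step ?T i = map move_right (?step t i)" if "i < k" for i
    using that k assms
    by (simp add: row_len_add_column rev_upt_Suc_shift comp_def del: upt_Suc)
  have zero: "row_len t (Suc k) = 0" 
    using k by (simp add: row_len_def)
  have "[0..<Suc m] = 0 # map Suc [0..<m]" for m
    by (simp add: map_Suc_upt upt_conv_Cons del: upt_Suc)
  then have lower: "?step ?T k = map move_right (?step t k) @ [Col 0]"
    using k assms zero by (simp add: row_len_add_column rev_map comp_def del: upt_Suc)
  have "border ?T = concat (map (?step ?T) [0..<k]) @ ?step ?T k"
    using k assms by (simp add: border_def nrows_def)
  also have "\<dots> = concat (map (\<lambda>i. map move_right (?step t i)) [0..<k]) @ map move_right (?step t k) @ [Col 0]"
    using upper unfolding lower by (metis (mono_tags, lifting) atLeastLessThan_iff map_cong set_upt)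
  also have "\<dots> = map move_right (border t) @ [Col 0]"
    using k by (simp add: border_def nrows_def map_concat comp_def)
  finally show ?thesis .
qed

lemma border_Nil [simp]: "border [] = []"
  by (simp add: border_def nrows_def)

lemma set_border:
  assumes "ferrers t"
  shows "set (border t) = Row ` {..<nrows t} \<union> Col ` {..<ncols t}"
  using assms
proof (induction rule: ferrers_induct)
  case Nil
  then show ?case by (simp add: nrows_def ncols_def row_len_def)
next
  case (row t)
  then show ?case by (auto simp: border_add_row nrows_def less_Suc_eq)
next
  case (column c t)
  have "move_right ` Col ` {..<m} \<union> {Col 0} = Col ` {..<Suc m}" for m
    by (simp add: lessThan_Suc_eq_insert_0 image_image)
  then show ?case
    using column by (auto simp: border_add_column ncols_add_column image_Un image_image)
qed

lemma Row_in_border [simp]: "ferrers t \<Longrightarrow> Row i \<in> set (border t) \<longleftrightarrow> i < nrows t"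
  and Col_in_border [simp]: "ferrers t \<Longrightarrow> Col j \<in> set (border t) \<longleftrightarrow> j < ncols t"
  by (auto simp: set_border)

lemma length_border: "ferrers t \<Longrightarrow> length (border t) = nrows t + ncols t"
proof (induction rule: ferrers_induct)
  case Nil
  then show ?case by (simp add: nrows_def ncols_def row_len_def)
qed (simp_all add: border_add_row border_add_column ncols_add_column)

text \<open>
  The order in which the steps occur on the border: a row step comes before a column step
  precisely when the row and the column share a cell. The entries of a tableau thus sit at the
  pairs of a row label and a larger column label.
\<close>

fun precedes :: "tableau \<Rightarrow> line \<Rightarrow> line \<Rightarrow> bool" where
  "precedes t (Row i) (Row i') \<longleftrightarrow> i < i'"
| "precedes t (Row i) (Col j) \<longleftrightarrow> j < row_len t i"
| "precedes t (Col j) (Row i) \<longleftrightarrow> row_len t i \<le> j"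
| "precedes t (Col j) (Col j') \<longleftrightarrow> j' < j"

lemma precedes_asym: "precedes t s s' \<Longrightarrow> \<not> precedes t s' s"
  by (cases s; cases s') auto

lemma precedes_move_right:
  assumes "length c = length t" "ferrers t" "s \<in> set (border t)" "s' \<in> set (border t)"
  shows "precedes (add_column c t) (move_right s) (move_right s') \<longleftrightarrow> precedes t s s'"
proof -
  have "i < length t" if "Row i = s \<or> Row i = s'" for i
    using that assms Row_in_border[OF assms(2)] by (auto simp: nrows_def)
  then have "row_len (add_column c t) i = Suc (row_len t i)" if "Row i = s \<or> Row i = s'" for i
    using that assms(1) by (auto simp: row_len_add_column)
  then show ?thesis
    by (cases s rule: line.exhaust; cases s' rule: line.exhaust) simp_all
qed

lemma sorted_border:
  assumes "ferrers t"
  shows "sorted_wrt (precedes t) (border t)"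
  using assms
proof (induction rule: ferrers_induct)
  case (row t)
  have "precedes (t @ [[]]) s s' \<longleftrightarrow> precedes t s s'" for s s'
    by (cases s; cases s') auto
  then have "precedes (t @ [[]]) = precedes t"
    by blast
  moreover have "precedes t s (Row (length t))" if "s \<in> set (border t)" for s
    using that row by (auto simp: set_border nrows_def row_len_def)
  ultimately show ?case
    using row by (auto simp: border_add_row sorted_wrt_append)
next
  case (column c t)
  have "sorted_wrt (\<lambda>s s'. precedes (add_column c t) (move_right s) (move_right s')) (border t)"
    by (rule sorted_wrt_mono_rel[OF _ column(4)]) (use column precedes_move_right in blast)
  moreover have "precedes (add_column c t) (move_right s) (Col 0)" if "s \<in> set (border t)" for s
    using that column(1,3) by (auto simp: set_border row_len_add_column nrows_def)
  ultimately show ?case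
    using column by (auto simp: border_add_column sorted_wrt_append sorted_wrt_map)
qed simp

lemma label_less_iff:
  assumes "ferrers t" "s \<in> set (border t)" "s' \<in> set (border t)" 
  shows "ew_label t s < ew_label t s' \<longleftrightarrow> precedes t s s'"
proof -
  have *: "precedes t s s'"
    if "s \<in> set (border t)" "s' \<in> set (border t)" "ew_label t s < ew_label t s'" for s s'
    using that sorted_wrt_nth_less[OF sorted_border[OF assms(1)], of "pos (border t) s" "pos (border t) s'"]
    by (simp add: ew_label_pos)
  show ?thesis
  proof (cases "s = s'")
    case True
    then show ?thesis using precedes_asym by auto
  next
    case False
    then have "ew_label t s \<noteq> ew_label t s'"
      using assms by (simp add: ew_label_pos pos_inject)
    then show ?thesis
      using * assms precedes_asym by (metis linorder_neqE_nat)
  qed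
qed

lemma distinct_border:
  assumes "ferrers t"
  shows "distinct (border t)"
proof -
  have "border t ! x \<noteq> border t ! y" if "x < y" "y < length (border t)" for x y
    using sorted_wrt_nth_less[OF sorted_border[OF assms] that] precedes_asym by metis
  then show ?thesis
    by (metis distinct_conv_nth linorder_neqE_nat)
qed


section \<open>The shape as a word of row and column steps\<close>

fun is_row :: "line \<Rightarrow> bool" where
  "is_row (Row i) = True"
| "is_row (Col j) = False"

lemma is_row_move_right [simp]: "is_row (move_right s) = is_row s"
  by (cases s) auto

text \<open>
  As a word of vertical and horizontal steps the border determines the shape.
\<close>

definition row_steps :: "tableau \<Rightarrow> bool list" where
  "row_steps t = map is_row (border t)"

lemma row_steps_Nil [simp]: "row_steps [] = []"
  by (simp add: row_steps_def)

lemma row_steps_add_row [simp]: "row_steps (t @ [[]]) = row_steps t @ [True]"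
  by (simp add: row_steps_def border_add_row)

lemma row_steps_add_column:
  "length c = length t \<Longrightarrow> t \<noteq> [] \<Longrightarrow> row_steps (add_column c t) = row_steps t @ [False]"
  by (simp add: row_steps_def border_add_column)

fun shape_of_steps :: "bool list \<Rightarrow> nat list" where
  "shape_of_steps [] = []"
| "shape_of_steps (True # v) = count_list v False # shape_of_steps v"
| "shape_of_steps (False # v) = shape_of_steps v"

lemma shape_of_steps_snoc:
  "shape_of_steps (v @ [True]) = shape_of_steps v @ [0]"
  "shape_of_steps (v @ [False]) = map Suc (shape_of_steps v)"
  by (induction v rule: shape_of_steps.induct) auto

lemma shape_eq_shape_of_steps: "ferrers t \<Longrightarrow> shape t = shape_of_steps (row_steps t)"
proof (induction rule: ferrers_induct)
  case (row t)
  then show ?case by (simp add: shape_of_steps_snoc) (simp add: shape_def)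
qed (simp_all add: shape_of_steps_snoc row_steps_add_column shape_add_column, simp add: shape_def)

lemma ferrers_with_row_steps:
  "v = [] \<or> hd v \<Longrightarrow> \<exists>t. ferrers t \<and> row_steps t = v"
proof (induction v rule: rev_induct)
  case Nil
  show ?case by (rule exI[of _ "[]"]) (simp add: ferrers_def shape_def)
next
  case (snoc b v)
  then have "v = [] \<or> hd v"
    by (cases v) auto
  then obtain t where t: "ferrers t" "row_steps t = v"
    using snoc.IH by blast
  show ?case
  proof (cases b)
    case True
    then show ?thesis
      using t by (intro exI[of _ "t @ [[]]"]) simp
  next
    case False
    then have "t \<noteq> []"
      using snoc.prems t by (cases v) auto
    then show ?thesis
      using t False
      by (intro exI[of _ "add_column (replicate (length t) True) t"]) (simp add: row_steps_add_column)
  qed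
qed

lemma row_len_shape: "row_len t i = (if i < length (shape t) then shape t ! i else 0)"
  by (simp add: row_len_def shape_def)

lemma shape_eqD:
  assumes "shape t = shape t'"
  shows "row_len t = row_len t'" "nrows t = nrows t'" "ncols t = ncols t'" "border t = border t'"
proof -
  show rows: "row_len t = row_len t'"
    using assms by (simp add: row_len_shape fun_eq_iff)
  show "nrows t = nrows t'"
    using arg_cong[OF assms, of length] by (simp add: shape_def nrows_def)
  then show "ncols t = ncols t'" "border t = border t'"
    using rows by (simp_all add: ncols_def border_def)
qed

lemma ew_label_inj_on: "inj_on (ew_label t) (set (border t))"
  by (rule inj_onI) (simp add: ew_label_pos pos_inject)

lemma ew_label_image:
  assumes "ferrers t"
  shows "ew_label t ` set (border t) = {..<nrows t + ncols t}"
proof -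
  have "x \<in> ew_label t ` set (border t)" if "x < length (border t)" for x
    using that distinct_border[OF assms]
    by (intro image_eqI[of _ _ "border t ! x"]) (simp_all add: ew_label_pos)
  then show ?thesis
    using assms by (auto simp: length_border[symmetric] ew_label_pos)
qed

lemma nth_border_ew_label: "s \<in> set (border t) \<Longrightarrow> border t ! ew_label t s = s"
  by (simp add: ew_label_pos)

lemma ew_label_nth_border:
  "ferrers t \<Longrightarrow> x < nrows t + ncols t \<Longrightarrow> ew_label t (border t ! x) = x"
  by (simp add: ew_label_pos distinct_border length_border)

lemma ew_label_top_row:
  assumes "ferrers t" "0 < nrows t"
  shows "ew_label t (Row 0) = 0"
proof -
  have top: "Row 0 \<in> set (border t)" and zero: "0 < nrows t + ncols t"
    using assms by simp_all
  then have first: "border t ! 0 \<in> set (border t)"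
    using assms(1) length_border by (metis nth_mem)
  then have "\<not> precedes t (border t ! 0) (Row 0)"
    using assms(1) by (cases "border t ! 0" rule: line.exhaust) (auto simp: ncols_def)
  then have "\<not> ew_label t (border t ! 0) < ew_label t (Row 0)"
    using label_less_iff[OF assms(1) first top] by simp
  then show ?thesis
    using ew_label_nth_border[OF assms(1) zero] by simp
qed

lemma cell_iff_label_less:
  assumes "ferrers t" "i < nrows t" "j < ncols t"
  shows "cell t i j \<longleftrightarrow> ew_label t (Row i) < ew_label t (Col j)"
  using assms by (simp add: label_less_iff cell_def nrows_def)

lemma cell_in_range:
  assumes "ferrers t" "cell t i j"
  shows "i < nrows t" "j < ncols t"
  using assms row_len_antimono[OF assms(1), of 0 i] by (auto simp: cell_def nrows_def ncols_def)


section \<open>Words with prescribed descent bottoms\<close>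

text \<open>
  The letter 0 is put in front so that the first letter of \<open>w\<close> is never a descent bottom.
\<close>

definition descent_bottoms :: "nat list \<Rightarrow> nat set" where
  "descent_bottoms w = {(0 # w) ! Suc p | p. p < length w \<and> (0 # w) ! Suc p < (0 # w) ! p}"

abbreviation descends_into :: "nat set \<Rightarrow> nat list \<Rightarrow> bool" where
  "descends_into R \<equiv> successively (\<lambda>x y. y < x \<longleftrightarrow> y \<in> R)"

lemma descends_into_iff:
  assumes "distinct w" "R \<subseteq> set w"
  shows "descends_into R (0 # w) \<longleftrightarrow> R = descent_bottoms w"
proof
  assume *: "descends_into R (0 # w)"
  have "y \<in> descent_bottoms w" if "y \<in> R" for y
  proof -
    have "y \<in> set w"
      using that assms(2) by blast
    then obtain p where "p < length w" "w ! p = y"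
      by (auto simp: in_set_conv_nth)
    then show ?thesis
      using * that by (force simp: descent_bottoms_def successively_conv_nth)
  qed
  moreover have "descent_bottoms w \<subseteq> R"
    using * by (auto simp: descent_bottoms_def successively_conv_nth)
  ultimately show "R = descent_bottoms w"
    by blast
next
  assume R: "R = descent_bottoms w"
  have "(0 # w) ! Suc p < (0 # w) ! p" if "p < length w" "(0 # w) ! Suc p \<in> R" for p
  proof -
    from that obtain q where "q < length w" "w ! q = w ! p" "(0 # w) ! Suc q < (0 # w) ! q"
      by (auto simp: R descent_bottoms_def)
    then show ?thesis
      using assms(1) that(1) by (auto simp: nth_eq_iff_index_eq)
  qed
  then show "descends_into R (0 # w)"
    by (auto simp: successively_conv_nth R descent_bottoms_def)
qed

text \<open>
  Going left from a descent bottom the letters increase until one that is not a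
  descent bottom is met. The run cannot pass a letter smaller than its starting point.
\<close>

lemma descent_run:
  assumes "descends_into R (z # u @ [y])" "y \<in> R" "z < y"
  shows "\<exists>c\<in>set u. c \<notin> R \<and> y < c"
  using assms
proof (induction u arbitrary: y rule: rev_induct)
  case (snoc y' u)
  have "descends_into R ((z # u @ [y']) @ [y])"
    using snoc.prems(1) by simp
  then have y': "y < y'" "descends_into R (z # u @ [y'])"
    unfolding successively_append_iff using snoc.prems(2) by simp_all
  show ?case
  proof (cases "y' \<in> R")
    case True
    then show ?thesis
      using snoc.IH[OF y'(2)] snoc.prems(3) y'(1) by force
  qed (use y' in auto)
qed auto

text \<open>
  The mirror image of \<open>descent_run\<close>: going left from a letter that is not a descent bottom, the letters
  decrease until a descent bottom is met.
\<close>

lemma ascent_run: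
  assumes "descends_into R (z # u @ [y])" "y \<notin> R" "y < z"
  shows "\<exists>r\<in>set u. r \<in> R \<and> r < y"
  using assms
proof (induction u arbitrary: y rule: rev_induct)
  case (snoc y' u)
  have "descends_into R ((z # u @ [y']) @ [y])"
    using snoc.prems(1) by simp
  then have y': "y' \<le> y" "descends_into R (z # u @ [y'])"
    unfolding successively_append_iff using snoc.prems(2) by simp_all
  show ?case
  proof (cases "y' \<in> R")
    case True
    then show ?thesis
      using y' snoc.prems(2) by (auto intro!: bexI[of _ y'] simp: le_less)
  next
    case False
    then show ?thesis
      using snoc.IH[OF y'(2)] snoc.prems(3) y'(1) by force
  qed
qed auto

lemma pos_less_append:
  "x \<in> set u \<Longrightarrow> y \<notin> set u \<Longrightarrow> pos (u @ v) x < pos (u @ v) y"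
  using pos_less_length[of u x] by (simp add: pos_append trans_less_add1 del: pos_less_length)

definition same_order :: "nat set \<Rightarrow> nat list \<Rightarrow> nat list \<Rightarrow> bool" where
  "same_order R w w' \<longleftrightarrow>
     (\<forall>r c. r \<in> set w \<and> r \<in> R \<and> c \<in> set w \<and> c \<notin> R \<and> r < c \<longrightarrow>
        (pos w r < pos w c \<longleftrightarrow> pos w' r < pos w' c))"

lemma same_orderD:
  assumes "same_order R w w'" "r \<in> set w" "r \<in> R" "c \<in> set w" "c \<notin> R" "r < c"
  shows "pos w r < pos w c \<longleftrightarrow> pos w' r < pos w' c"
  using assms unfolding same_order_def by blast

text \<open>
  Suppose two words with the same descent bottoms part at the letters \<open>x\<close> and \<open>y\<close>. If both
  are descent bottoms and \<open>x < y\<close>, then in the word starting with \<open>x\<close> a larger non-descent-bottom comes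
  before \<open>y\<close>, whereas \<open>y\<close> comes first in the other word; dually if neither is a descent bottom.
  If only \<open>y\<close> is, the common preceding letter lies between them, so \<open>y < x\<close>, and the
  order of \<open>x\<close> and \<open>y\<close> themselves differs. Up to exchanging the two words there is no
  further case.
\<close>

lemma first_letters_differ:
  assumes w: "descends_into R (z # x # u)" "distinct (x # u)"
    and w': "descends_into R (z # y # u')" "distinct (y # u')"
    and sets: "set (x # u) = set (y # u')"
    and order: "same_order R (x # u) (y # u')"
    and less: "x \<in> R \<and> y \<in> R \<and> x < y \<or> x \<notin> R \<and> y \<notin> R \<and> x < y \<or> x \<notin> R \<and> y \<in> R"
  shows False
  using less
proof (elim disjE conjE)
  assume "x \<in> R" "y \<in> R" "x < y"
  then have "y \<in> set u"
    using sets by auto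
  then obtain u1 u2 where u: "u = u1 @ y # u2"
    by (meson split_list)
  have "descends_into R ((x # u1 @ [y]) @ u2)"
    using w(1) u by simp
  then have "descends_into R (x # u1 @ [y])"
    unfolding successively_append_iff by blast
  then obtain c where c: "c \<in> set u1" "c \<notin> R" "y < c"
    using descent_run \<open>y \<in> R\<close> \<open>x < y\<close> by blast
  have "pos (x # u) c < pos (x # u) y"
    using pos_less_append[of c "x # u1" y "y # u2"] c w(2) u by auto
  moreover have "pos (y # u') y < pos (y # u') c"
    using c by simp
  ultimately show False
    using same_orderD[OF order, of y c] c u \<open>y \<in> R\<close> by simp
next
  assume "x \<notin> R" "y \<notin> R" "x < y"
  then have "x \<in> set u'"
    using sets by auto
  then obtain u1 u2 where u': "u' = u1 @ x # u2"
    by (meson split_list)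
  have "descends_into R ((y # u1 @ [x]) @ u2)"
    using w'(1) u' by simp
  then have "descends_into R (y # u1 @ [x])"
    unfolding successively_append_iff by blast
  then obtain r where r: "r \<in> set u1" "r \<in> R" "r < x"
    using ascent_run \<open>x \<notin> R\<close> \<open>x < y\<close> by blast
  have "pos (y # u') r < pos (y # u') x"
    using pos_less_append[of r "y # u1" x "x # u2"] r w'(2) u' by auto
  moreover have "\<not> pos (x # u) r < pos (x # u) x"
    by simp
  moreover have "r \<in> set (x # u)"
    using sets r u' by auto
  ultimately show False
    using same_orderD[OF order, of r x] r \<open>x \<notin> R\<close> by simp
next
  assume "x \<notin> R" "y \<in> R"
  then have "y < x"
    using w(1) w'(1) by auto
  moreover have "pos (y # u') y < pos (y # u') x"
    using \<open>y < x\<close> by simp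
  moreover have "y \<in> set (x # u)"
    using sets by auto
  ultimately show False
    using same_orderD[OF order, of y x] \<open>x \<notin> R\<close> \<open>y \<in> R\<close> by simp
qed

lemma descends_into_unique:
  assumes "descends_into R (z # w)" "descends_into R (z # w')"
    and "distinct w" "distinct w'" "set w = set w'" "same_order R w w'"
  shows "w = w'"
  using assms
proof (induction w arbitrary: z w')
  case (Cons x u)
  then obtain y u' where w': "w' = y # u'"
    by (cases w') auto
  have "same_order R (y # u') (x # u)"
    using Cons.prems w' by (auto simp: same_order_def)
  then have "x = y"
    using first_letters_differ[of R z x u y u'] first_letters_differ[of R z y u' x u] Cons.prems w'
    by (metis linorder_neqE_nat)
  have "set u = set u'"
    using Cons.prems w' \<open>x = y\<close> by auto
  moreover have "same_order R u u'"
    unfolding same_order_def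
  proof (intro allI impI)
    fix r c assume *: "r \<in> set u \<and> r \<in> R \<and> c \<in> set u \<and> c \<notin> R \<and> r < c"
    then have "r \<noteq> x" "c \<noteq> x"
      using Cons.prems by auto
    then show "pos u r < pos u c \<longleftrightarrow> pos u' r < pos u' c"
      using same_orderD[OF Cons.prems(6), of r c] * w' \<open>x = y\<close> by simp
  qed
  ultimately show ?case
    using Cons w' \<open>x = y\<close> by auto
qed simp


section \<open>Reading an EW-tableau\<close>

definition row_labels :: "tableau \<Rightarrow> nat set" where
  "row_labels t = {ew_label t (Row i) | i. 0 < i \<and> i < nrows t}"

definition reads :: "tableau \<Rightarrow> nat list \<Rightarrow> bool" where
  "reads t w \<longleftrightarrow>
     w \<in> permutations_of_set {1..<nrows t + ncols t} \<and>
     descends_into (row_labels t) (0 # w) \<and>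
     (\<forall>i j. 0 < i \<and> cell t i j \<longrightarrow>
        (t ! i ! j \<longleftrightarrow> pos w (ew_label t (Row i)) < pos w (ew_label t (Col j))))"

text \<open>
  If every row in \<open>R\<close> had a 0 and every column a 1, following them would yield
  a closed walk alternating between 0s and 1s, and the shape has enough cells to cut it down to a
  rectangle. The proof takes the shortest row \<open>r\<close>: on its columns \<open>Cr\<close> all rows of \<open>R\<close> have cells,
  so that there the sets of 1s in the columns form a chain. A smallest such set consists
  of rows that are full on \<open>Cr\<close>, and the induction continues with these rows, from which \<open>r\<close> is
  missing.
\<close>

lemma alternating_cycle_free:
  fixes len :: "'a \<Rightarrow> nat" and one :: "'a \<Rightarrow> nat \<Rightarrow> bool"
  assumes "finite R" "R \<noteq> {}"
    and rectangle: "\<And>i i' j j'. \<lbrakk>i \<in> R; i' \<in> R; j < len i; j' < len i; j < len i'; j' < len i';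
        \<not> one i j; one i j'; one i' j; \<not> one i' j'\<rbrakk> \<Longrightarrow> False"
    and columns: "\<And>i j. \<lbrakk>j \<in> C; i \<in> R; j < len i\<rbrakk> \<Longrightarrow> \<exists>i\<in>R. j < len i \<and> one i j"
  shows "\<exists>i\<in>R. \<forall>j\<in>C. j < len i \<longrightarrow> one i j"
  using assms
proof (induction "card R" arbitrary: R C rule: less_induct)
  case less
  note fin = less.prems(1) and rectangle = less.prems(3) and columns = less.prems(4)
  obtain r where r: "r \<in> R" "\<And>i. i \<in> R \<Longrightarrow> len r \<le> len i"
    using ex_has_least_nat[of "\<lambda>i. i \<in> R" _ len] less.prems(2) by blast
  define Cr where "Cr = {j \<in> C. j < len r}"
  define ones where "ones j = {i \<in> R. one i j}" for j
  have short: "j < len i" if "j \<in> Cr" "i \<in> R" for i j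
    using that r(2)[of i] by (auto simp: Cr_def)
  show ?case
  proof (cases "\<forall>j\<in>Cr. one r j")
    case True
    then show ?thesis
      using r(1) by (auto simp: Cr_def)
  next
    case False
    then obtain j1 where "j1 \<in> Cr"
      by blast
    then obtain j0 where j0: "j0 \<in> Cr" "\<And>j. j \<in> Cr \<Longrightarrow> card (ones j0) \<le> card (ones j)"
      using ex_has_least_nat[of "\<lambda>j. j \<in> Cr" _ "\<lambda>j. card (ones j)"] by blast
    have "finite (ones j)" for j
      using fin by (simp add: ones_def)
    have full: "one i j" if i: "i \<in> ones j0" and j: "j \<in> Cr" for i j
    proof (rule ccontr)
      assume zero: "\<not> one i j"
      have "\<not> ones j \<subseteq> ones j0"
      proof
        assume "ones j \<subseteq> ones j0"
        then have "ones j = ones j0"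
          using j0(2)[OF j] \<open>finite (ones j0)\<close> by (metis card_seteq)
        then have "i \<in> ones j"
          using i by simp
        then show False
          using zero by (simp add: ones_def)
      qed
      then obtain i' where "i' \<in> R" "one i' j" "\<not> one i' j0"
        by (auto simp: ones_def)
      then show False
        using rectangle[of i i' j j0] zero i short j j0(1) by (auto simp: ones_def)
    qed
    define R' where "R' = {i \<in> R. \<forall>j\<in>Cr. one i j}"
    have "r \<notin> R'"
      using False by (simp add: R'_def)
    then have "R' \<subset> R"
      using r(1) by (auto simp: R'_def)
    obtain i0 where "i0 \<in> R" "one i0 j0"
      using columns[of j0 r] j0(1) r(1) by (auto simp: Cr_def)
    then have "i0 \<in> R'"
      using full[of i0] by (simp add: R'_def ones_def)
    then have "R' \<noteq> {}"
      by blast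
    have "\<exists>i\<in>R'. \<forall>j\<in>C. j < len i \<longrightarrow> one i j"
    proof (rule less.hyps)
      show "card R' < card R" "finite R'" "R' \<noteq> {}"
        using psubset_card_mono[OF fin] \<open>R' \<subset> R\<close> finite_subset[OF _ fin] \<open>R' \<noteq> {}\<close> by auto
      show False if "i \<in> R'" "i' \<in> R'" "j < len i" "j' < len i" "j < len i'" "j' < len i'"
        "\<not> one i j" "one i j'" "one i' j" "\<not> one i' j'" for i i' j j'
        using rectangle[of i i' j j'] that \<open>R' \<subset> R\<close> by auto
      show "\<exists>i\<in>R'. j < len i \<and> one i j" if j: "j \<in> C" "i \<in> R'" "j < len i" for i j
      proof (rule ccontr)
        assume none: "\<not> (\<exists>i\<in>R'. j < len i \<and> one i j)"
        obtain i1 where i1: "i1 \<in> R" "j < len i1" "one i1 j"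
          using columns[OF j(1) _ j(3)] j(2) \<open>R' \<subset> R\<close> by auto
        then have "i1 \<notin> R'"
          using none by blast
        then obtain j2 where "j2 \<in> Cr" "\<not> one i1 j2"
          using i1(1) by (auto simp: R'_def)
        then show False
          using rectangle[of i1 i j2 j] i1 j none short by (auto simp: R'_def)
      qed
    qed
    then show ?thesis
      using \<open>R' \<subset> R\<close> by blast
  qed
qed

lemma pos_append_mono:
  "pos w x < pos w y \<Longrightarrow> y \<in> set w \<Longrightarrow> pos (w @ v) x < pos (w @ v) y"
  using pos_less_length[of w] by (metis order.strict_trans pos_append)

lemma image_mset_partition:
  "image_mset f M = image_mset f (filter_mset P M) + image_mset f (filter_mset (\<lambda>x. \<not> P x) M)"
  by (metis image_mset_union multiset_partition)

lemma le_last_if_sorted: "sorted_wrt (<) xs \<Longrightarrow> x \<in> set xs \<Longrightarrow> x \<le> last (xs :: nat list)"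
  by (induction xs rule: rev_induct) (auto simp: sorted_wrt_append less_imp_le)

lemma last_le_if_sorted: "sorted_wrt (>) xs \<Longrightarrow> x \<in> set xs \<Longrightarrow> last (xs :: nat list) \<le> x"
  by (induction xs rule: rev_induct) (auto simp: sorted_wrt_append less_imp_le)

context
  fixes t :: tableau
  assumes ew: "ew_tableau t"
begin

abbreviation row_label where "row_label i \<equiv> ew_label t (Row i)"
abbreviation col_label where "col_label j \<equiv> ew_label t (Col j)"

lemma ew_ferrers: "ferrers t"
  using ew by (simp add: ew_tableau_def)

lemma ew_nrows: "0 < nrows t"
  using ew by (simp add: ew_tableau_def nrows_def)

lemma ew_zero: "0 < i \<Longrightarrow> i < nrows t \<Longrightarrow> \<exists>j. cell t i j \<and> \<not> t ! i ! j"
  using ew by (simp add: ew_tableau_def)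

lemma ew_rectangle:
  assumes "cell t i j" "cell t i j'" "cell t i' j" "cell t i' j'"
    and "\<not> t ! i ! j" "t ! i ! j'" "t ! i' ! j" "\<not> t ! i' ! j'"
  shows False
proof -
  have no: "\<not> (i < i' \<and> j < j' \<and> cell t i j \<and> cell t i j' \<and> cell t i' j \<and> cell t i' j' \<and>
          (\<not> t ! i ! j \<and> \<not> t ! i' ! j' \<and> t ! i ! j' \<and> t ! i' ! j \<or>
           t ! i ! j \<and> t ! i' ! j' \<and> \<not> t ! i ! j' \<and> \<not> t ! i' ! j))" for i i' j j'
    using ew unfolding ew_tableau_def by blast
  have "i \<noteq> i'" "j \<noteq> j'"
    using assms by auto
  then consider "i < i'" "j < j'" | "i < i'" "j' < j" | "i' < i" "j < j'" | "i' < i" "j' < j"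
    by linarith
  then show False
    using assms no[of i i' j j'] no[of i i' j' j] no[of i' i j j'] no[of i' i j' j] by cases auto
qed

definition initial_labels :: "nat list" where
  "initial_labels = map row_label (rev [1..<nrows t]) @ map col_label (rev [0..<ncols t])"

lemma distinct_initial_labels: "distinct initial_labels"
  and set_initial_labels: "set initial_labels = {1..<nrows t + ncols t}"
proof -
  let ?steps = "map Row (rev [1..<nrows t]) @ map Col (rev [0..<ncols t])"
  have labels: "initial_labels = map (ew_label t) ?steps"
    by (simp add: initial_labels_def)
  have steps: "set ?steps = set (border t) - {Row 0}"
    using ew_ferrers by (auto simp: set_border)
  have "distinct ?steps"
    by (auto simp: distinct_map inj_on_def)
  then show "distinct initial_labels"
    unfolding labels distinct_map steps
    by (blast intro: inj_on_subset[OF ew_label_inj_on])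
  have "set initial_labels = ew_label t ` set (border t) - ew_label t ` {Row 0}"
    unfolding labels set_map steps
    using ew_label_inj_on[of t] ew_ferrers ew_nrows by (intro inj_on_image_set_diff) auto
  also have "\<dots> = {..<nrows t + ncols t} - {0}"
    using ew_label_image[OF ew_ferrers] ew_label_top_row[OF ew_ferrers ew_nrows] by simp
  also have "\<dots> = {1..<nrows t + ncols t}"
    by (simp add: set_eq_iff) linarith
  finally show "set initial_labels = {1..<nrows t + ncols t}" .
qed

text \<open>
  The last two conditions only concern letters already written: a 1 (a 0) forces the row (the column)
  to precede the column (the row) as soon as the latter has been written.
\<close>

definition reading_invariant :: "psi_state \<Rightarrow> bool" where
  "reading_invariant = (\<lambda>(rs, cs, w).
     sorted_wrt (>) rs \<and> sorted_wrt (>) cs \<and> set rs \<subseteq> {1..<nrows t} \<and> set cs \<subseteq> {..<ncols t} \<and>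
     mset (w @ map row_label rs @ map col_label cs) = mset initial_labels \<and>
     descends_into (row_labels t) (0 # w) \<and>
     (\<forall>i j. 0 < i \<and> cell t i j \<longrightarrow>
        (t ! i ! j \<longrightarrow> col_label j \<in> set w \<longrightarrow> pos w (row_label i) < pos w (col_label j)) \<and>
        (\<not> t ! i ! j \<longrightarrow> row_label i \<in> set w \<longrightarrow> pos w (col_label j) < pos w (row_label i))))"

text \<open>
  Ready for a column step: every unread row still has a 0, and a column that has no 1 left has a
  label exceeding the last letter, so that writing it creates no descent. The next
  definition is the exact counterpart before a row step, with every written row creating a descent.
\<close>

definition columns_next :: "psi_state \<Rightarrow> bool" where
  "columns_next = (\<lambda>(rs, cs, w).
     (\<forall>i\<in>set rs. \<exists>j\<in>set cs. cell t i j \<and> \<not> t ! i ! j) \<and>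
     (\<forall>j\<in>set cs. (\<exists>i\<in>set rs. cell t i j \<and> t ! i ! j) \<or> last (0 # w) < col_label j))"

definition rows_next :: "psi_state \<Rightarrow> bool" where
  "rows_next = (\<lambda>(rs, cs, w).
     (\<forall>j\<in>set cs. \<exists>i\<in>set rs. cell t i j \<and> t ! i ! j) \<and>
     (\<forall>i\<in>set rs. (\<exists>j\<in>set cs. cell t i j \<and> \<not> t ! i ! j) \<or> row_label i < last (0 # w)))"

lemma label_inject:
  "i < nrows t \<Longrightarrow> i' < nrows t \<Longrightarrow> row_label i = row_label i' \<longleftrightarrow> i = i'"
  "j < ncols t \<Longrightarrow> j' < ncols t \<Longrightarrow> col_label j = col_label j' \<longleftrightarrow> j = j'"
  "i < nrows t \<Longrightarrow> j < ncols t \<Longrightarrow> row_label i \<noteq> col_label j"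
  "i < nrows t \<Longrightarrow> j < ncols t \<Longrightarrow> col_label j \<noteq> row_label i"
  using ew_ferrers by (auto simp: inj_on_eq_iff[OF ew_label_inj_on])

lemma inj_on_row_label: "inj_on row_label {..<nrows t}" and inj_on_col_label: "inj_on col_label {..<ncols t}"
  by (auto simp: inj_on_def label_inject)

lemma label_less:
  "i < nrows t \<Longrightarrow> i' < nrows t \<Longrightarrow> row_label i < row_label i' \<longleftrightarrow> i < i'"
  "j < ncols t \<Longrightarrow> j' < ncols t \<Longrightarrow> col_label j < col_label j' \<longleftrightarrow> j' < j"
  using ew_ferrers by (auto simp: label_less_iff)

lemma column_not_row_label: "j < ncols t \<Longrightarrow> col_label j \<notin> row_labels t"
  using label_inject(4) by (auto simp: row_labels_def)

lemma reading_invariant_labels: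
  assumes "reading_invariant (rs, cs, w)"
  shows "distinct (w @ map row_label rs @ map col_label cs)"
    and "0 < i \<Longrightarrow> i < nrows t \<Longrightarrow> row_label i \<in> set w \<longleftrightarrow> i \<notin> set rs"
    and "j < ncols t \<Longrightarrow> col_label j \<in> set w \<longleftrightarrow> j \<notin> set cs"
proof -
  have eq: "mset (w @ map row_label rs @ map col_label cs) = mset initial_labels"
    and ranges: "set rs \<subseteq> {1..<nrows t}" "set cs \<subseteq> {..<ncols t}"
    using assms by (simp_all add: reading_invariant_def)
  show dist: "distinct (w @ map row_label rs @ map col_label cs)"
    using mset_eq_imp_distinct_iff[OF eq] distinct_initial_labels by simp
  have labels: "set (w @ map row_label rs @ map col_label cs) = set initial_labels"
    using mset_eq_setD[OF eq] .
  show "row_label i \<in> set w \<longleftrightarrow> i \<notin> set rs" if i: "0 < i" "i < nrows t"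
  proof -
    have "row_label i \<in> set initial_labels"
      using i by (simp add: initial_labels_def)
    moreover have "row_label i \<in> row_label ` set rs \<longleftrightarrow> i \<in> set rs"
      using i ranges(1) by (intro inj_on_image_mem_iff[OF inj_on_row_label]) auto
    moreover have "row_label i \<notin> col_label ` set cs"
      using label_inject(3)[OF i(2)] ranges(2) by (auto simp: subset_iff)
    ultimately show ?thesis
      unfolding labels[symmetric] using dist by auto
  qed
  show "col_label j \<in> set w \<longleftrightarrow> j \<notin> set cs" if j: "j < ncols t"
  proof -
    have "col_label j \<in> set initial_labels"
      using j by (simp add: initial_labels_def)
    moreover have "col_label j \<in> col_label ` set cs \<longleftrightarrow> j \<in> set cs"
      using j ranges(2) by (intro inj_on_image_mem_iff[OF inj_on_col_label]) auto
    moreover have "col_label j \<notin> row_label ` set rs"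
    proof
      assume "col_label j \<in> row_label ` set rs"
      then obtain i where "i \<in> set rs" "row_label i = col_label j"
        by auto
      then show False
        using label_inject(3)[of i j] ranges(1) j by auto
    qed
    ultimately show ?thesis
      unfolding labels[symmetric] using dist by auto
  qed
qed

lemma cell_label_bounds: "cell t i j \<Longrightarrow> i < nrows t" "cell t i j \<Longrightarrow> j < ncols t"
  using cell_in_range[OF ew_ferrers] by blast+

lemma cell_label_less: "cell t i j \<Longrightarrow> row_label i < col_label j"
  using cell_iff_label_less[OF ew_ferrers] cell_label_bounds by blast

text \<open>
  The columns to be written have increasing labels and none is a descent bottom.
  A row whose last 0s are thereby deleted has a smaller label than one of these columns, hence than
  the last letter; this is what \<open>rows_next\<close> demands.
\<close>

lemma columns_step:
  assumes inv: "reading_invariant (rs, cs, w)" and ready: "columns_next (rs, cs, w)"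
    and step: "psi_columns t (rs, cs, w) = (rs', cs', w')"
  shows "reading_invariant (rs', cs', w')" "rows_next (rs', cs', w')" "rs' = rs"
    and "rs \<noteq> [] \<or> cs \<noteq> [] \<Longrightarrow> length cs' < length cs"
proof -
  define no_ones where "no_ones j \<longleftrightarrow> (\<forall>i\<in>set rs. cell t i j \<longrightarrow> \<not> t ! i ! j)" for j
  define block where "block = filter no_ones cs"
  have new: "rs' = rs" "cs' = filter (\<lambda>j. \<not> no_ones j) cs" "w' = w @ map col_label block"
    using step by (auto simp: psi_columns_def block_def no_ones_def[abs_def] Let_def)
  have sorted: "sorted_wrt (>) rs" "sorted_wrt (>) cs"
    and ranges: "set rs \<subseteq> {1..<nrows t}" "set cs \<subseteq> {..<ncols t}"
    and labels: "mset (w @ map row_label rs @ map col_label cs) = mset initial_labels"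
    and descends: "descends_into (row_labels t) (0 # w)"
    and ones: "\<And>i j. \<lbrakk>0 < i; cell t i j; t ! i ! j; col_label j \<in> set w\<rbrakk> \<Longrightarrow> pos w (row_label i) < pos w (col_label j)"
    and zeros: "\<And>i j. \<lbrakk>0 < i; cell t i j; \<not> t ! i ! j; row_label i \<in> set w\<rbrakk> \<Longrightarrow> pos w (col_label j) < pos w (row_label i)"
    using inv by (simp_all add: reading_invariant_def)
  note read = reading_invariant_labels[OF inv]
  have block_cols: "j < ncols t" if "j \<in> set block" for j
    using that ranges(2) by (auto simp: block_def)
  have increasing: "sorted_wrt (<) (map col_label block)"
    unfolding sorted_wrt_map block_def
    by (rule sorted_wrt_mono_rel[OF _ sorted_wrt_filter[OF sorted(2)]])
      (use ranges(2) label_less(2) in auto)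
  have "successively (\<lambda>x y. y < x \<longleftrightarrow> y \<in> row_labels t) (map col_label block)"
    by (rule successively_mono[OF successively_if_sorted_wrt[OF increasing]])
      (use block_cols column_not_row_label in auto)
  moreover have "last (0 # w) < hd (map col_label block) \<and> hd (map col_label block) \<notin> row_labels t" if "block \<noteq> []"
  proof -
    have "hd block \<in> set block"
      using that by simp
    moreover from this have "hd block \<in> set cs" "no_ones (hd block)"
      by (auto simp: block_def)
    ultimately show ?thesis
      using ready that block_cols column_not_row_label
      by (auto simp: columns_next_def no_ones_def hd_map)
  qed
  ultimately have descends': "descends_into (row_labels t) ((0 # w) @ map col_label block)"
    unfolding successively_append_iff using descends by auto
  have labels': "mset (w' @ map row_label rs' @ map col_label cs') = mset initial_labels"
    unfolding labels[symmetric] new block_def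
    by (simp add: image_mset_partition[of col_label "mset cs" no_ones])
  show "reading_invariant (rs', cs', w')"
    unfolding reading_invariant_def prod.case
  proof (intro conjI allI impI; (elim conjE)?)
    show "sorted_wrt (>) rs'" "sorted_wrt (>) cs'" "set rs' \<subseteq> {1..<nrows t}" "set cs' \<subseteq> {..<ncols t}"
      using sorted ranges by (auto simp: new sorted_wrt_filter)
    show "mset (w' @ map row_label rs' @ map col_label cs') = mset initial_labels"
      by (fact labels')
    show "descends_into (row_labels t) (0 # w')"
      using descends' by (simp add: new)
  next
    fix i j assume ij: "0 < i" "cell t i j" "t ! i ! j" "col_label j \<in> set w'"
    show "pos w' (row_label i) < pos w' (col_label j)"
    proof (cases "col_label j \<in> set w")
      case True
      show ?thesis
        unfolding new by (rule pos_append_mono[OF ones[OF ij(1-3) True] True])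
    next
      case False
      then have "j \<in> set block"
        using ij(2,4) label_inject(2) block_cols cell_label_bounds by (auto simp: new)
      then have "i \<notin> set rs"
        using ij by (auto simp: block_def no_ones_def)
      then show ?thesis
        unfolding new
        using False read(2)[OF ij(1) cell_label_bounds(1)[OF ij(2)]] by (intro pos_less_append) auto
    qed
  next
    fix i j assume ij: "0 < i" "cell t i j" "\<not> t ! i ! j" "row_label i \<in> set w'"
    have read_i: "row_label i \<in> set w"
      using ij(4) block_cols label_inject(3) cell_label_bounds(1)[OF ij(2)] by (auto simp: new)
    show "pos w' (col_label j) < pos w' (row_label i)"
      unfolding new by (rule pos_append_mono[OF zeros[OF ij(1-3) read_i] read_i])
  qed
  show "rows_next (rs', cs', w')"
    unfolding rows_next_def prod.case
  proof (intro conjI ballI)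
    fix j assume "j \<in> set cs'"
    then show "\<exists>i\<in>set rs'. cell t i j \<and> t ! i ! j"
      by (auto simp: new no_ones_def)
  next
    fix i assume "i \<in> set rs'"
    then obtain j where j: "j \<in> set cs" "cell t i j" "\<not> t ! i ! j"
      using ready by (auto simp: new columns_next_def)
    show "(\<exists>j\<in>set cs'. cell t i j \<and> \<not> t ! i ! j) \<or> row_label i < last (0 # w')"
    proof (cases "j \<in> set block")
      case True
      then have "col_label j \<le> last (map col_label block)"
        using le_last_if_sorted[OF increasing] by simp
      then show ?thesis
        using cell_label_less[OF j(2)] True by (auto simp: new last_append)
    next
      case False
      then show ?thesis
        using j by (auto simp: new block_def)
    qed
  qed
  show "rs' = rs"
    by (fact new)
  show "length cs' < length cs" if nonempty: "rs \<noteq> [] \<or> cs \<noteq> []"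
  proof -
    \<comment> \<open>If rows are left, each of them has a 0, so some column must be free of 1s.\<close>
    have "\<exists>j\<in>set cs. no_ones j"
    proof (cases "rs = []")
      case True
      then show ?thesis
        using nonempty by (cases cs) (auto simp: no_ones_def)
    next
      case False
      show ?thesis
      proof (rule ccontr)
        assume "\<not> (\<exists>j\<in>set cs. no_ones j)"
        then have one: "\<exists>i\<in>set rs. cell t i j \<and> t ! i ! j" if "j \<in> set cs" for j
          using that by (auto simp: no_ones_def)
        have rows: "i < length t" if "i \<in> set rs" for i
          using that ranges(1) by (auto simp: nrows_def)
        have "\<exists>i\<in>set rs. \<forall>j\<in>set cs. j < row_len t i \<longrightarrow> t ! i ! j"
        proof (rule alternating_cycle_free)
          show False if "i \<in> set rs" "i' \<in> set rs" "j < row_len t i" "j' < row_len t i"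
            "j < row_len t i'" "j' < row_len t i'"
            "\<not> t ! i ! j" "t ! i ! j'" "t ! i' ! j" "\<not> t ! i' ! j'" for i i' j j'
            using that rows ew_rectangle[of i j j' i'] by (simp add: cell_def)
        qed (use False one in \<open>auto simp: cell_def\<close>)
        then show False
          using ready by (auto simp: columns_next_def cell_def)
      qed
    qed
    then show ?thesis
      unfolding new by (auto intro: length_filter_less)
  qed
qed

lemma rows_step:
  assumes inv: "reading_invariant (rs, cs, w)" and ready: "rows_next (rs, cs, w)"
    and step: "psi_rows t (rs, cs, w) = (rs', cs', w')"
  shows "reading_invariant (rs', cs', w')" "columns_next (rs', cs', w')" "cs' = cs" "length rs' \<le> length rs"
proof -
  define no_zeros where "no_zeros i \<longleftrightarrow> (\<forall>j\<in>set cs. cell t i j \<longrightarrow> t ! i ! j)" for i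
  define block where "block = filter no_zeros rs"
  have new: "cs' = cs" "rs' = filter (\<lambda>j. \<not> no_zeros j) rs" "w' = w @ map row_label block"
    using step by (auto simp: psi_rows_def block_def no_zeros_def[abs_def] Let_def)
  have sorted: "sorted_wrt (>) rs" "sorted_wrt (>) cs"
    and ranges: "set rs \<subseteq> {1..<nrows t}" "set cs \<subseteq> {..<ncols t}"
    and labels: "mset (w @ map row_label rs @ map col_label cs) = mset initial_labels"
    and descends: "descends_into (row_labels t) (0 # w)"
    and ones: "\<And>i j. \<lbrakk>0 < i; cell t i j; t ! i ! j; col_label j \<in> set w\<rbrakk> \<Longrightarrow> pos w (row_label i) < pos w (col_label j)"
    and zeros: "\<And>i j. \<lbrakk>0 < i; cell t i j; \<not> t ! i ! j; row_label i \<in> set w\<rbrakk> \<Longrightarrow> pos w (col_label j) < pos w (row_label i)"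
    using inv by (simp_all add: reading_invariant_def)
  note read = reading_invariant_labels[OF inv]
  have block_rows: "0 < i" "i < nrows t" if "i \<in> set block" for i
    using that ranges(1) by (auto simp: block_def)
  have block_labels: "row_label i \<in> row_labels t" if "i \<in> set block" for i
    using block_rows[OF that] by (auto simp: row_labels_def)
  have decreasing: "sorted_wrt (>) (map row_label block)"
    unfolding sorted_wrt_map block_def
    by (rule sorted_wrt_mono_rel[OF _ sorted_wrt_filter[OF sorted(1)]])
      (use ranges(1) label_less(1) in auto)
  have "successively (\<lambda>x y. y < x \<longleftrightarrow> y \<in> row_labels t) (map row_label block)"
    by (rule successively_mono[OF successively_if_sorted_wrt[OF decreasing]])
      (use block_labels in auto)
  moreover have "hd (map row_label block) < last (0 # w) \<and> hd (map row_label block) \<in> row_labels t" if "block \<noteq> []"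
  proof -
    have "hd block \<in> set block"
      using that by simp
    moreover from this have "hd block \<in> set rs" "no_zeros (hd block)"
      by (auto simp: block_def)
    ultimately show ?thesis
      using ready that block_labels
      by (auto simp: rows_next_def no_zeros_def hd_map)
  qed
  ultimately have descends': "descends_into (row_labels t) ((0 # w) @ map row_label block)"
    unfolding successively_append_iff using descends by auto
  have labels': "mset (w' @ map row_label rs' @ map col_label cs') = mset initial_labels"
    unfolding labels[symmetric] new block_def
    by (simp add: image_mset_partition[of row_label "mset rs" no_zeros])
  show "reading_invariant (rs', cs', w')"
    unfolding reading_invariant_def prod.case
  proof (intro conjI allI impI; (elim conjE)?)
    show "sorted_wrt (>) rs'" "sorted_wrt (>) cs'" "set rs' \<subseteq> {1..<nrows t}" "set cs' \<subseteq> {..<ncols t}"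
      using sorted ranges by (auto simp: new sorted_wrt_filter)
    show "mset (w' @ map row_label rs' @ map col_label cs') = mset initial_labels"
      by (fact labels')
    show "descends_into (row_labels t) (0 # w')"
      using descends' by (simp add: new)
  next
    fix i j assume ij: "0 < i" "cell t i j" "t ! i ! j" "col_label j \<in> set w'"
    have read_j: "col_label j \<in> set w"
      using ij(4) block_rows label_inject(4) cell_label_bounds(2)[OF ij(2)] by (auto simp: new)
    show "pos w' (row_label i) < pos w' (col_label j)"
      unfolding new by (rule pos_append_mono[OF ones[OF ij(1-3) read_j] read_j])
  next
    fix i j assume ij: "0 < i" "cell t i j" "\<not> t ! i ! j" "row_label i \<in> set w'"
    show "pos w' (col_label j) < pos w' (row_label i)"
    proof (cases "row_label i \<in> set w")
      case True
      show ?thesis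
        unfolding new by (rule pos_append_mono[OF zeros[OF ij(1-3) True] True])
    next
      case False
      then have "i \<in> set block"
        using ij(2,4) label_inject(1) block_rows cell_label_bounds by (auto simp: new)
      then have "j \<notin> set cs"
        using ij by (auto simp: block_def no_zeros_def)
      then show ?thesis
        unfolding new
        using False read(3)[OF cell_label_bounds(2)[OF ij(2)]] by (intro pos_less_append) auto
    qed
  qed
  show "columns_next (rs', cs', w')"
    unfolding columns_next_def prod.case
  proof (intro conjI ballI)
    fix i assume "i \<in> set rs'"
    then show "\<exists>j\<in>set cs'. cell t i j \<and> \<not> t ! i ! j"
      by (auto simp: new no_zeros_def)
  next
    fix j assume "j \<in> set cs'"
    then obtain i where i: "i \<in> set rs" "cell t i j" "t ! i ! j"
      using ready by (auto simp: new rows_next_def)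
    show "(\<exists>i\<in>set rs'. cell t i j \<and> t ! i ! j) \<or> last (0 # w') < col_label j"
    proof (cases "i \<in> set block")
      case True
      then have "last (map row_label block) \<le> row_label i"
        using last_le_if_sorted[OF decreasing] by simp
      then show ?thesis
        using cell_label_less[OF i(2)] True by (auto simp: new last_append)
    next
      case False
      then show ?thesis
        using i by (auto simp: new block_def)
    qed
  qed
  show "cs' = cs" "length rs' \<le> length rs"
    by (simp_all add: new)
qed

lemma reads_Psi: "reads t (Psi t)"
proof -
  let ?going = "\<lambda>(rs :: nat list, cs :: nat list, w :: nat list). rs \<noteq> [] \<or> cs \<noteq> []"
  let ?step = "psi_rows t \<circ> psi_columns t"
  let ?good = "\<lambda>s. reading_invariant s \<and> columns_next s"
  let ?size = "\<lambda>(rs :: nat list, cs :: nat list, w :: nat list). length rs + length cs"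
  have "(\<lambda>(rs, cs, w). reads t w) (while ?going ?step (rev [1..<nrows t], rev [0..<ncols t], []))"
  proof (rule while_rule2[where P = ?good and r = "measure ?size"])
    have "\<exists>j\<in>set (rev [0..<ncols t]). cell t i j \<and> \<not> t ! i ! j" if "i \<in> set (rev [1..<nrows t])" for i
      using ew_zero[of i] that cell_label_bounds(2) by auto
    moreover have "0 < col_label j" if "j < ncols t" for j
      using label_inject(4)[OF ew_nrows that] ew_label_top_row[OF ew_ferrers ew_nrows] by simp
    ultimately show "?good (rev [1..<nrows t], rev [0..<ncols t], [])"
      by (simp add: reading_invariant_def columns_next_def initial_labels_def sorted_wrt_rev strict_sorted_iff
          lessThan_atLeast0 del: upt_Suc)
  next
    fix s assume good: "?good s" and going: "?going s"
    obtain rs cs w where s: "s = (rs, cs, w)" by (cases s)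
    obtain rs1 cs1 w1 where s1: "psi_columns t s = (rs1, cs1, w1)" by (cases "psi_columns t s")
    obtain rs2 cs2 w2 where s2: "psi_rows t (rs1, cs1, w1) = (rs2, cs2, w2)"
      by (cases "psi_rows t (rs1, cs1, w1)")
    note c = columns_step[of rs cs w rs1 cs1 w1, folded s, OF _ _ s1]
    have "reading_invariant (rs1, cs1, w1)" "rows_next (rs1, cs1, w1)" "rs1 = rs" "length cs1 < length cs"
      using c good going s by auto
    moreover from this have "reading_invariant (rs2, cs2, w2)" "columns_next (rs2, cs2, w2)" "cs2 = cs1"
      "length rs2 \<le> length rs1"
      using rows_step[OF _ _ s2] by auto
    ultimately show "?good (?step s) \<and> (?step s, s) \<in> measure ?size"
      using s1 s2 s by simp
  next
    fix s assume good: "?good s" and "\<not> ?going s"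
    then obtain w where s: "s = ([], [], w)"
      by (cases s) auto
    then have inv: "reading_invariant ([], [], w)"
      using good by simp
    then have eq: "mset w = mset initial_labels"
      by (simp add: reading_invariant_def)
    have "w \<in> permutations_of_set {1..<nrows t + ncols t}"
      using mset_eq_setD[OF eq] mset_eq_imp_distinct_iff[OF eq] distinct_initial_labels set_initial_labels
      by auto
    moreover have "t ! i ! j \<longleftrightarrow> pos w (row_label i) < pos w (col_label j)" if ij: "0 < i" "cell t i j" for i j
    proof -
      have "row_label i \<in> set w" "col_label j \<in> set w"
        using reading_invariant_labels[OF inv] ij cell_label_bounds by auto
      then show ?thesis
        using inv ij unfolding reading_invariant_def by (auto dest: less_asym)
    qed
    ultimately show "(\<lambda>(rs, cs, w). reads t w) s"
      using inv by (simp add: s reads_def reading_invariant_def)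
  qed simp
  then show ?thesis
    by (simp add: Psi_def case_prod_beta)
qed

end


lemma row_labels_subset:
  assumes "ferrers t" "0 < nrows t"
  shows "row_labels t \<subseteq> {1..<nrows t + ncols t}"
proof
  fix y assume "y \<in> row_labels t"
  then obtain i where i: "0 < i" "i < nrows t" "y = ew_label t (Row i)"
    by (auto simp: row_labels_def)
  have "ew_label t (Row 0) < ew_label t (Row i)"
    using assms i by (simp add: label_less_iff)
  moreover have "y < nrows t + ncols t"
    using ew_label_image[OF assms(1)] i assms(1) by (auto simp: set_border)
  ultimately show "y \<in> {1..<nrows t + ncols t}"
    using i by auto
qed

lemma nth_row_steps:
  assumes "ferrers t" "0 < nrows t" "x < nrows t + ncols t"
  shows "row_steps t ! x \<longleftrightarrow> x = 0 \<or> x \<in> row_labels t"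
proof -
  have x: "x < length (border t)" "ew_label t (border t ! x) = x" "border t ! x \<in> set (border t)"
    using assms by (simp_all add: length_border ew_label_nth_border)
  show ?thesis
  proof (cases "border t ! x" rule: line.exhaust)
    case (Row i)
    then show ?thesis
      using x assms ew_label_top_row[OF assms(1,2)]
      by (cases "i = 0") (auto simp: row_steps_def row_labels_def)
  next
    case (Col j)
    have "x \<noteq> ew_label t (Row i)" if "i < nrows t" for i
      using that x Col assms(1) nth_border_ew_label[of "Row i" t] by auto
    then have "x \<noteq> 0" "x \<notin> row_labels t"
      using assms(2) ew_label_top_row[OF assms(1,2)] by (fastforce simp: row_labels_def)+
    then show ?thesis
      using Col x by (simp add: row_steps_def)
  qed
qed

lemma reads_row_labels:
  assumes "ew_tableau t" "reads t w"
  shows "row_labels t = descent_bottoms w"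
  using assms row_labels_subset[OF ew_ferrers ew_nrows]
    descends_into_iff[of w "row_labels t"] permutations_of_setD[of w]
  by (auto simp: reads_def)

lemma reads_row_steps:
  assumes "ew_tableau t" "reads t w"
  shows "row_steps t = map (\<lambda>x. x = 0 \<or> x \<in> descent_bottoms w) [0..<nrows t + ncols t]"
  using reads_row_labels[OF assms] nth_row_steps[OF ew_ferrers ew_nrows] assms(1)
  by (intro nth_equalityI) (simp_all add: row_steps_def length_border ew_ferrers)

lemma reads_unique_word:
  assumes t: "ew_tableau t" and w: "reads t w" and w': "reads t w'"
  shows "w = w'"
proof (rule descends_into_unique)
  show "descends_into (row_labels t) (0 # w)" "descends_into (row_labels t) (0 # w')"
    using w w' by (simp_all add: reads_def)
  have sets: "set w = {1..<nrows t + ncols t}"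
    using w by (auto simp: reads_def dest: permutations_of_setD)
  then show "distinct w" "distinct w'" "set w = set w'"
    using w w' by (auto simp: reads_def dest: permutations_of_setD)
  show "same_order (row_labels t) w w'"
    unfolding same_order_def
  proof (intro allI impI, elim conjE)
    fix r c assume rc: "r \<in> set w" "r \<in> row_labels t" "c \<in> set w" "c \<notin> row_labels t" "r < c"
    obtain i where i: "0 < i" "i < nrows t" "r = ew_label t (Row i)"
      using rc by (auto simp: row_labels_def)
    have c: "0 < c" "c < nrows t + ncols t"
      using rc sets by auto
    then have "\<not> row_steps t ! c"
      using nth_row_steps[OF ew_ferrers[OF t] ew_nrows[OF t] c(2)] rc by simp
    moreover have "border t ! c \<in> set (border t)" "ew_label t (border t ! c) = c"
      using c ew_ferrers[OF t] by (simp_all add: length_border ew_label_nth_border)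
    ultimately obtain j where j: "j < ncols t" "c = ew_label t (Col j)"
      using c ew_ferrers[OF t]
      by (cases "border t ! c" rule: line.exhaust) (auto simp: row_steps_def length_border)
    then have "cell t i j"
      using i rc(5) cell_iff_label_less[OF ew_ferrers[OF t] i(2) j(1)] by simp
    then show "pos w r < pos w c \<longleftrightarrow> pos w' r < pos w' c"
      using w w' i j by (simp add: reads_def)
  qed
qed

lemma reads_unique_tableau:
  assumes t: "ew_tableau t" and t': "ew_tableau t'" and w: "reads t w" "reads t' w"
    and size: "nrows t + ncols t = nrows t' + ncols t'"
  shows "t = t'"
proof -
  have "row_steps t = row_steps t'"
    using reads_row_steps[OF t w(1)] reads_row_steps[OF t' w(2)] size by simp
  then have shape: "shape t = shape t'"
    using ew_ferrers[OF t] ew_ferrers[OF t'] by (simp add: shape_eq_shape_of_steps)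
  note eq = shape_eqD[OF shape]
  have label: "ew_label t s = ew_label t' s" for s
    using eq by (simp add: ew_label_pos)
  have cell: "cell t i j = cell t' i j" for i j
    using eq by (simp add: cell_def nrows_def)
  show ?thesis
  proof (intro nth_equalityI)
    show "length t = length t'"
      using eq by (simp add: nrows_def)
    fix i assume i: "i < length t"
    then show "length (t ! i) = length (t' ! i)"
      using fun_cong[OF eq(1), of i] eq(2) by (simp add: nrows_def row_len_def)
    fix j assume "j < length (t ! i)"
    then have ij: "cell t i j"
      using i by (simp add: cell_def row_len_def)
    show "t ! i ! j = t' ! i ! j"
    proof (cases "i = 0")
      case True
      then show ?thesis
        using ij cell t t' by (auto simp: ew_tableau_def)
    next
      case False
      then show ?thesis
        using ij w unfolding reads_def cell label by simp
    qed
  qed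
qed

definition tableau_of_word :: "tableau \<Rightarrow> nat list \<Rightarrow> tableau" where
  "tableau_of_word t w =
     map (\<lambda>i. map (\<lambda>j. pos (0 # w) (ew_label t (Row i)) < pos (0 # w) (ew_label t (Col j)))
            [0..<row_len t i]) [0..<nrows t]"

lemma shape_tableau_of_word: "shape (tableau_of_word t w) = shape t"
  by (rule nth_equalityI) (simp_all add: shape_def tableau_of_word_def row_len_def nrows_def)

text \<open>
  The row labels are 0 and the descent bottoms, and the entries are read off from the order of the letters
  in \<open>0 # w\<close>. A forbidden rectangle would be a cycle in that order. A row other than the top one
  has a 0 because some larger letter that is not a descent bottom precedes its label, by
  \<open>descent_run\<close>.
\<close>

lemma reads_exists:
  assumes w: "w \<in> permutations_of_set {1..n}" and n: "1 \<le> n"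
  shows "\<exists>t\<in>EW n. reads t w"
proof -
  note w_set = permutations_of_setD[OF w]
  let ?D = "descent_bottoms w"
  let ?v = "map (\<lambda>x. x = 0 \<or> x \<in> ?D) [0..<Suc n]"
  have D: "?D \<subseteq> set w"
    by (auto simp: descent_bottoms_def)
  have descends: "descends_into ?D (0 # w)"
    using descends_into_iff[OF w_set(2) D] by simp
  have "hd ?v"
    by (simp add: hd_map del: upt_Suc)
  then obtain s where s: "ferrers s" "row_steps s = ?v"
    using ferrers_with_row_steps[of ?v] by blast
  define t where "t = tableau_of_word s w"
  note eq = shape_eqD[OF shape_tableau_of_word[of s w], folded t_def]
  have ferrers: "ferrers t"
    using s(1) by (simp add: ferrers_def t_def shape_tableau_of_word)
  have steps: "row_steps t = ?v"
    using s(2) eq(4) by (simp add: row_steps_def)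
  have size: "nrows t + ncols t = Suc n"
    using arg_cong[OF steps, of length] length_border[OF ferrers] by (simp add: row_steps_def)
  have "border t ! 0 \<in> set (border t)" "is_row (border t ! 0)"
    using arg_cong[OF steps, of "\<lambda>v. v ! 0"] size length_border[OF ferrers]
    by (simp_all add: row_steps_def nth_append del: upt_Suc)
  then have rows: "0 < nrows t"
    using ferrers by (cases "border t ! 0" rule: line.exhaust) auto
  have top: "ew_label t (Row 0) = 0"
    by (rule ew_label_top_row[OF ferrers rows])
  have labels: "x = 0 \<or> x \<in> row_labels t \<longleftrightarrow> x = 0 \<or> x \<in> ?D" if "x < Suc n" for x
    using nth_row_steps[OF ferrers rows, of x] that size steps by (simp add: nth_append del: upt_Suc)
  have row_labels: "row_labels t = ?D"
  proof (rule set_eqI)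
    fix x
    show "x \<in> row_labels t \<longleftrightarrow> x \<in> ?D"
    proof (cases "0 < x \<and> x < Suc n")
      case True
      then show ?thesis using labels[of x] by simp
    next
      case False
      then show ?thesis
        using subsetD[OF row_labels_subset[OF ferrers rows], of x] subsetD[OF D, of x] w_set(1) size
        by auto
    qed
  qed
  have cell: "cell t i j \<longleftrightarrow> i < nrows t \<and> j < row_len t i" for i j
    by (auto simp: cell_def nrows_def)
  have entry: "t ! i ! j \<longleftrightarrow> pos (0 # w) (ew_label t (Row i)) < pos (0 # w) (ew_label t (Col j))"
    if "cell t i j" for i j
    using that eq unfolding cell
    by (simp add: t_def tableau_of_word_def ew_label_pos)
  have col: "\<exists>j. j < ncols t \<and> c = ew_label t (Col j)" if "c \<in> set w" "c \<notin> ?D" for c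
  proof -
    have c: "0 < c" "c < Suc n"
      using that w_set(1) by auto
    then have "\<not> is_row (border t ! c)" "border t ! c \<in> set (border t)" "ew_label t (border t ! c) = c"
      using arg_cong[OF steps, of "\<lambda>v. v ! c"] that(2) size ferrers
      by (simp_all add: row_steps_def length_border ew_label_nth_border del: upt_Suc)
    then show ?thesis
      using ferrers by (cases "border t ! c" rule: line.exhaust) auto
  qed
  have "n \<notin> ?D"
  proof
    assume "n \<in> ?D"
    then obtain p where p: "p < length w" "n < (0 # w) ! p"
      by (auto simp: descent_bottoms_def)
    then have "(0 # w) ! p \<in> set (0 # w)"
      by (intro nth_mem) simp
    then show False
      using p w_set(1) by auto
  qed
  moreover have "n \<in> set w"
    using w_set(1) n by simp
  ultimately obtain jn where jn: "jn < ncols t" "n = ew_label t (Col jn)"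
    using col by blast
  have row_nonempty: "cell t i jn" if i: "i < nrows t" for i
  proof -
    have "ew_label t (Row i) \<noteq> n"
      using i ferrers jn by (auto simp: inj_on_eq_iff[OF ew_label_inj_on])
    moreover have "ew_label t (Row i) < Suc n"
      using ew_label_image[OF ferrers] i size ferrers by (auto simp: set_border)
    ultimately show ?thesis
      using cell_iff_label_less[OF ferrers i jn(1)] jn(2) by simp
  qed
  have zero: "\<exists>j. cell t i j \<and> \<not> t ! i ! j" if i: "0 < i" "i < nrows t" for i
  proof -
    define y where "y = ew_label t (Row i)"
    have "y \<in> ?D"
      using i row_labels by (auto simp: row_labels_def y_def)
    then have "y \<in> set w" "0 < y"
      using D w_set(1) by auto
    then obtain u v where uv: "w = u @ y # v"
      by (meson split_list)
    have "descends_into ?D ((0 # u @ [y]) @ v)"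
      using descends uv by simp
    then have "descends_into ?D (0 # u @ [y])"
      unfolding successively_append_iff by blast
    then obtain c where c: "c \<in> set u" "c \<notin> ?D" "y < c"
      using descent_run \<open>y \<in> ?D\<close> \<open>0 < y\<close> by blast
    then obtain j where j: "j < ncols t" "c = ew_label t (Col j)"
      using col uv by auto
    have "pos w c < pos w y"
      unfolding uv using c(1) w_set(2) uv by (intro pos_less_append) auto
    moreover have "cell t i j"
      using cell_iff_label_less[OF ferrers i(2) j(1)] c(3) j y_def by simp
    ultimately show ?thesis
      by (intro exI[of _ j]) (use entry[of i j] j y_def c(3) \<open>0 < y\<close> in auto)
  qed
  have "ew_tableau t"
    unfolding ew_tableau_def
  proof (intro conjI)
    show "t \<noteq> []" "ferrers t"
      using rows ferrers by (auto simp: nrows_def)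
    show "\<forall>r\<in>set t. r \<noteq> []"
      using row_nonempty by (fastforce simp: in_set_conv_nth cell_def row_len_def nrows_def)
    show "\<forall>j. cell t 0 j \<longrightarrow> t ! 0 ! j"
    proof (intro allI impI)
      fix j assume c: "cell t 0 j"
      have "ew_label t (Row 0) < ew_label t (Col j)"
        using cell_iff_label_less[OF ferrers] cell_in_range[OF ferrers c] c by blast
      then show "t ! 0 ! j"
        using entry[OF c] top by simp
    qed
    show "\<forall>i. 0 < i \<and> i < nrows t \<longrightarrow> (\<exists>j. cell t i j \<and> \<not> t ! i ! j)"
      using zero by blast
    have "\<not> (cell t i j \<and> cell t i j' \<and> cell t i' j \<and> cell t i' j' \<and>
          (\<not> t ! i ! j \<and> \<not> t ! i' ! j' \<and> t ! i ! j' \<and> t ! i' ! j \<or>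
           t ! i ! j \<and> t ! i' ! j' \<and> \<not> t ! i ! j' \<and> \<not> t ! i' ! j))" for i i' j j'
      using entry[of i j] entry[of i j'] entry[of i' j] entry[of i' j'] by linarith
    then show "\<not> (\<exists>i i' j j'. i < i' \<and> j < j' \<and>
          cell t i j \<and> cell t i j' \<and> cell t i' j \<and> cell t i' j' \<and>
          (\<not> t ! i ! j \<and> \<not> t ! i' ! j' \<and> t ! i ! j' \<and> t ! i' ! j \<or>
           t ! i ! j \<and> t ! i' ! j' \<and> \<not> t ! i ! j' \<and> \<not> t ! i' ! j))"
      by blast
  qed
  moreover have "reads t w"
    unfolding reads_def
  proof (intro conjI allI impI, goal_cases)
    case 1
    have "{1..<nrows t + ncols t} = {1..n}"
      using size by auto
    then show ?case
      using w by simp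
  next
    case 2
    show ?case
      using descends row_labels by simp
  next
    case (3 i j)
    have "ew_label t (Row i) \<noteq> 0"
      using 3 row_labels_subset[OF ferrers rows] cell_in_range[OF ferrers, of i j]
      by (force simp: row_labels_def)
    moreover have "ew_label t (Row i) < ew_label t (Col j)"
      using cell_iff_label_less[OF ferrers] cell_in_range[OF ferrers, of i j] 3 by blast
    ultimately show ?case
      using entry[of i j] 3 by simp
  qed
  ultimately show ?thesis
    using size by (auto simp: EW_def)
qed

lemma EW_size:
  assumes "t \<in> EW n"
  shows "ew_tableau t" "nrows t + ncols t = Suc n" "{1..<nrows t + ncols t} = {1..n}"
  using assms by (auto simp: EW_def ew_tableau_def nrows_def)

theorem bij_betw_Psi:
  assumes "1 \<le> n"
  shows "bij_betw Psi (EW n) (permutations_of_set {1..n})"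
  unfolding bij_betw_def
proof
  show "inj_on Psi (EW n)"
  proof (rule inj_onI)
    fix t t' assume "t \<in> EW n" "t' \<in> EW n" "Psi t = Psi t'"
    then show "t = t'"
      using EW_size[of t n] EW_size[of t' n] reads_Psi[of t] reads_Psi[of t']
        reads_unique_tableau[of t t' "Psi t"] by simp
  qed
  show "Psi ` EW n = permutations_of_set {1..n}"
  proof (intro equalityI subsetI)
    fix w assume "w \<in> Psi ` EW n"
    then show "w \<in> permutations_of_set {1..n}"
      using EW_size reads_Psi by (metis (no_types, lifting) image_iff reads_def)
  next
    fix w assume "w \<in> permutations_of_set {1..n}"
    then obtain t where t: "t \<in> EW n" "reads t w"
      using reads_exists assms by blast
    then have "Psi t = w"
      using EW_size(1) reads_Psi reads_unique_word by blast
    then show "w \<in> Psi ` EW n"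
      using t by blast
  qed
qed


section \<open>The map DE\<close>

text \<open>
  The letters of \<open>0 # w\<close> are kept in the form \<open>(0 # w) ! i\<close>, without a case distinction on \<open>i\<close>.
\<close>

declare nth_Cons_pos [simp del]

text \<open>
  The place of the letter \<open>a\<^sub>i\<close> in \<open>DE w\<close> is itself a letter of \<open>w\<close>, at this index. If \<open>a\<^sub>i\<close> is smaller
  than all later letters, the index is that of the first letter after the previous such right-to-left minimum.
\<close>

definition DE_index :: "nat list \<Rightarrow> nat \<Rightarrow> nat" where
  "DE_index w i =
     (if \<exists>j\<in>{i<..length w}. (0 # w) ! j < (0 # w) ! i then i + 1
      else Max {k \<in> {..<i}. (0 # w) ! k < (0 # w) ! i} + 1)"

lemma DE_place_index: "DE_place w i = (0 # w) ! DE_index w i"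
  by (simp add: DE_place_def DE_index_def Let_def)

context
  fixes w :: "nat list"
  assumes w: "distinct w" "0 \<notin> set w"
begin

abbreviation letter where "letter i \<equiv> (0 # w) ! i"

lemma letter_inject: "i \<le> length w \<Longrightarrow> j \<le> length w \<Longrightarrow> letter i = letter j \<longleftrightarrow> i = j"
  using w nth_eq_iff_index_eq[of "0 # w" i j] by simp

lemma letter_pos: "0 < i \<Longrightarrow> i \<le> length w \<Longrightarrow> 0 < letter i"
  using letter_inject[of i 0] by simp

lemma DE_index_descent:
  "j \<in> {i<..length w} \<Longrightarrow> letter j < letter i \<Longrightarrow> DE_index w i = Suc i"
  by (auto simp: DE_index_def)

lemma DE_index_minimum:
  assumes i: "0 < i" "i \<le> length w" and min: "\<And>j. j \<in> {i<..length w} \<Longrightarrow> letter i < letter j"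
  obtains k where "DE_index w i = Suc k" "k < i" "letter k < letter i"
    "\<And>l. k < l \<Longrightarrow> l < i \<Longrightarrow> letter i < letter l"
proof -
  let ?K = "{k \<in> {..<i}. letter k < letter i}"
  have "0 \<in> ?K"
    using i letter_pos by auto
  then have "Max ?K \<in> ?K"
    by (intro Max_in) auto
  moreover have "letter i < letter l" if "Max ?K < l" "l < i" for l
  proof -
    have "l \<notin> ?K"
    proof
      assume "l \<in> ?K"
      then have "l \<le> Max ?K"
        by (intro Max_ge) auto
      then show False
        using that(1) by simp
    qed
    then show ?thesis
      using that i letter_inject[of l i] by auto
  qed
  moreover have "DE_index w i = Suc (Max ?K)"
    using min by (fastforce simp: DE_index_def)
  ultimately show ?thesis
    using that by blast
qed

lemma DE_index_cases:
  assumes "0 < i" "i \<le> length w"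
  obtains (descent) j where "DE_index w i = Suc i" "i < j" "j \<le> length w" "letter j < letter i"
    | (minimum) k where "\<And>j. j \<in> {i<..length w} \<Longrightarrow> letter i < letter j"
      "DE_index w i = Suc k" "k < i" "letter k < letter i"
      "\<And>l. k < l \<Longrightarrow> l < i \<Longrightarrow> letter i < letter l"
proof (cases "\<exists>j\<in>{i<..length w}. letter j < letter i")
  case True
  then show ?thesis using descent DE_index_descent by auto
next
  case False
  then have "letter i < letter j" if "j \<in> {i<..length w}" for j
    using that letter_inject[of i j] assms by force
  then show ?thesis
    using DE_index_minimum[OF assms] minimum by metis
qed

lemma DE_index_inj: "inj_on (DE_index w) {1..length w}"
proof (rule inj_onI)
  have *: "DE_index w i \<noteq> DE_index w i'" if "i < i'" "0 < i" "i' \<le> length w" for i i'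
  proof
    assume eq: "DE_index w i = DE_index w i'"
    have i: "0 < i" "i \<le> length w" and i': "0 < i'" "i' \<le> length w"
      using that by auto
    show False
      using i
    proof (cases rule: DE_index_cases)
      case d: (descent j)
      show False
        using i'
      proof (cases rule: DE_index_cases)
        case (descent j')
        then show False using d eq that by simp
      next
        case (minimum k)
        then have "k = i"
          using d eq by simp
        then show False
          using d minimum(1)[of j] minimum(4) minimum(5)[of j] by (cases j i' rule: linorder_cases) auto
      qed
    next
      case m: (minimum k)
      show False
        using i'
      proof (cases rule: DE_index_cases)
        case (descent j')
        then show False using m eq that by simp
      next
        case (minimum k')
        then have "k' < i"
          using m eq by simp
        then have "letter i' < letter i"
          using minimum(5) that by blast
        then show False
          using m(1)[of i'] that by auto
      qed
    qed
  qed
  fix i i' assume "i \<in> {1..length w}" "i' \<in> {1..length w}" "DE_index w i = DE_index w i'"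
  then show "i = i'"
    using *[of i i'] *[of i' i] by (cases i i' rule: linorder_cases) auto
qed

lemma DE_index_range: "i \<in> {1..length w} \<Longrightarrow> DE_index w i \<in> {1..length w}"
proof -
  assume "i \<in> {1..length w}"
  then have i: "0 < i" "i \<le> length w"
    by auto
  then show ?thesis
    by (cases rule: DE_index_cases) (use i in auto)
qed

lemma DE_exceeds_iff:
  assumes "0 < i" "i \<le> length w"
  shows "DE_place w i < letter i \<longleftrightarrow> letter (DE_index w i) < letter (DE_index w i - 1)"
  using assms
proof (cases rule: DE_index_cases)
  case (descent j)
  then show ?thesis by (simp add: DE_place_index)
next
  case (minimum k)
  have "letter i \<le> letter (Suc k)"
    using minimum(3) minimum(5)[of "Suc k"] by (cases "Suc k = i") (auto simp del: nth_Cons_Suc)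
  then show ?thesis
    using minimum by (simp add: DE_place_index)
qed

end

lemma length_fold_update: "length (fold (\<lambda>i b. b[f i := g i]) is b) = length b"
  by (induction "is" arbitrary: b) auto

lemma nth_fold_update_other:
  "p \<notin> f ` set is \<Longrightarrow> fold (\<lambda>i b. b[f i := g i]) is b ! p = b ! p"
  by (induction "is" arbitrary: b) auto

lemma nth_fold_update:
  assumes "distinct is" "inj_on f (set is)" "i \<in> set is" "f i < length b"
  shows "fold (\<lambda>i b. b[f i := g i]) is b ! f i = g i"
  using assms
proof (induction "is" arbitrary: b)
  case (Cons a "is")
  then have *: "f a \<notin> f ` set is"
    by (auto simp: inj_on_def)
  then show ?case
    using Cons by (cases "i = a") (auto simp: nth_fold_update_other)
qed simp

lemma length_DE [simp]: "length (DE w) = length w"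
  by (simp add: DE_def length_fold_update del: upt_Suc)

context
  fixes n :: nat and w :: "nat list"
  assumes w: "w \<in> permutations_of_set {1..n}"
begin

lemma word_facts: "distinct w" "0 \<notin> set w" "set w = {1..n}" "length w = n"
  using permutations_of_setD[OF w] length_finite_permutations_of_set[OF w] by auto

lemma nth_word: "0 < i \<Longrightarrow> i \<le> n \<Longrightarrow> (0 # w) ! i \<in> {1..n}"
  using word_facts nth_mem[of "i - 1" w] by (simp add: nth_Cons')

lemma DE_place_range: "i \<in> {1..n} \<Longrightarrow> DE_place w i \<in> {1..n}"
  using DE_index_range[OF word_facts(1,2), of i] word_facts(4) nth_word[of "DE_index w i"]
  by (simp add: DE_place_index)

lemma DE_place_inj: "inj_on (DE_place w) {1..n}"
proof (rule inj_onI)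
  fix i i' assume *: "i \<in> {1..n}" "i' \<in> {1..n}" "DE_place w i = DE_place w i'"
  then have "DE_index w i = DE_index w i'"
    using DE_index_range[OF word_facts(1,2), of i] DE_index_range[OF word_facts(1,2), of i'] word_facts(4)
      letter_inject[OF word_facts(1,2), of "DE_index w i" "DE_index w i'"] by (simp add: DE_place_index)
  then show "i = i'"
    using * inj_onD[OF DE_index_inj[OF word_facts(1,2)], of i i'] word_facts(4) by simp
qed

lemma DE_place_image: "DE_place w ` {1..n} = {1..n}"
  using DE_place_inj DE_place_range by (intro endo_inj_surj) auto

lemma nth_DE: "i \<in> {1..n} \<Longrightarrow> DE w ! (DE_place w i - 1) = (0 # w) ! i"
proof -
  assume i: "i \<in> {1..n}"
  have "inj_on (\<lambda>i. DE_place w i - 1) {1..n}"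
  proof (rule inj_onI)
    fix i i' assume "i \<in> {1..n}" "i' \<in> {1..n}" "DE_place w i - 1 = DE_place w i' - 1"
    then show "i = i'"
      using DE_place_range[of i] DE_place_range[of i'] inj_onD[OF DE_place_inj, of i i'] by auto
  qed
  moreover have "set [1..<Suc n] = {1..n}"
    by auto
  ultimately show ?thesis
    unfolding DE_def using i DE_place_range[OF i] word_facts(4)
    by (intro nth_fold_update) (auto simp del: upt_Suc)
qed

lemma DE_perm: "DE w \<in> permutations_of_set {1..n}"
proof -
  have "set w \<subseteq> set (DE w)"
  proof
    fix x assume "x \<in> set w"
    then obtain p where p: "p < n" "x = w ! p"
      using word_facts(4) by (metis in_set_conv_nth)
    have "DE_place w (Suc p) - 1 < length (DE w)"
      using DE_place_range[of "Suc p"] p word_facts(4) by auto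
    then show "x \<in> set (DE w)"
      using nth_DE[of "Suc p"] p by (metis Suc_eq_plus1 Suc_leI atLeastAtMost_iff le_add2 nth_Cons_Suc nth_mem)
  qed
  then have sub: "{1..n} \<subseteq> set (DE w)"
    using word_facts by simp
  have card: "card (set (DE w)) \<le> n"
    using card_length[of "DE w"] word_facts(4) by simp
  then have eq: "set (DE w) = {1..n}"
    using card_seteq[OF _ sub] by simp
  then have "distinct (DE w)"
    using word_facts(4) by (intro card_distinct) simp
  then show ?thesis
    using eq by blast
qed

lemma DE_excedance_iff:
  assumes "p \<in> {1..n}"
  shows "p < DE w ! (p - 1) \<longleftrightarrow> p \<in> descent_bottoms w"
proof -
  obtain i where i: "i \<in> {1..n}" "p = DE_place w i"
    using DE_place_image assms by (metis image_iff)
  define q where "q = DE_index w i"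
  have q: "q \<in> {1..n}" "p = (0 # w) ! q"
    using DE_index_range[OF word_facts(1,2), of i] i word_facts(4) by (simp_all add: q_def DE_place_index)
  have "p < DE w ! (p - 1) \<longleftrightarrow> (0 # w) ! q < (0 # w) ! (q - 1)"
    using DE_exceeds_iff[OF word_facts(1,2), of i] i nth_DE[OF i(1)] word_facts(4) by (simp add: q_def)
  also have "\<dots> \<longleftrightarrow> p \<in> descent_bottoms w"
  proof
    assume "(0 # w) ! q < (0 # w) ! (q - 1)"
    then show "p \<in> descent_bottoms w"
      unfolding descent_bottoms_def q(2) using q(1) word_facts(4) by (intro CollectI exI[of _ "q - 1"]) auto
  next
    assume "p \<in> descent_bottoms w"
    then obtain r where r: "p = (0 # w) ! Suc r" "r < n" "(0 # w) ! Suc r < (0 # w) ! r"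
      by (auto simp: descent_bottoms_def word_facts(4))
    then have "Suc r = q"
      using letter_inject[OF word_facts(1,2), of "Suc r" q] q word_facts(4) by simp
    then show "(0 # w) ! q < (0 # w) ! (q - 1)"
      using r by auto
  qed
  finally show ?thesis .
qed

text \<open>
  If \<open>a\<^sub>i\<close> is not smaller than all later letters, then \<open>a\<^sub>i\<close> sits at place \<open>a\<^sub>i\<^sub>+\<^sub>1\<close> of \<open>DE w\<close>. Otherwise a
  new block begins after \<open>a\<^sub>i\<close>, and that place holds the end of the block, the next right-to-left minimum, which
  is the least of the letters to come. In both cases the value is known from the first \<open>i\<close>
  letters.
\<close>

lemma DE_next_letter:
  assumes i: "i < n"
  shows "DE w ! ((0 # w) ! Suc i - 1) =
    (if \<exists>x\<in>set (drop i w). x < (0 # w) ! i then (0 # w) ! i else Min (set (drop i w)))"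
proof -
  have later: "x \<in> set (drop i w) \<longleftrightarrow> (\<exists>j\<in>{i<..n}. x = (0 # w) ! j)" for x
  proof
    assume "x \<in> set (drop i w)"
    then obtain q where "q < n - i" "x = w ! (i + q)"
      using word_facts(4) by (auto simp: in_set_conv_nth)
    then show "\<exists>j\<in>{i<..n}. x = (0 # w) ! j"
      by (intro bexI[of _ "Suc (i + q)"]) auto
  next
    assume "\<exists>j\<in>{i<..n}. x = (0 # w) ! j"
    then obtain j where "i < j" "j \<le> n" "x = w ! (j - 1)"
      by (auto simp: nth_Cons')
    then show "x \<in> set (drop i w)"
      using word_facts(4) by (auto simp: in_set_conv_nth intro!: exI[of _ "j - 1 - i"])
  qed
  show ?thesis
  proof (cases "\<exists>x\<in>set (drop i w). x < (0 # w) ! i")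
    case True
    then obtain j where j: "j \<in> {i<..n}" "(0 # w) ! j < (0 # w) ! i"
      using later by auto
    then have "0 < i"
      by (cases i) auto
    then have "DE_place w i = (0 # w) ! Suc i"
      using j DE_index_descent[OF word_facts(1,2)] word_facts(4) by (simp add: DE_place_index)
    then show ?thesis
      using True nth_DE[of i] \<open>0 < i\<close> i by simp
  next
    case False
    define m where "m = Min (set (drop i w))"
    have ne: "set (drop i w) \<noteq> {}"
      using i word_facts(4) by simp
    then have "m \<in> set (drop i w)"
      unfolding m_def by (intro Min_in) auto
    then obtain p where p: "p \<in> {i<..n}" "m = (0 # w) ! p"
      using later by auto
    have least: "m \<le> (0 # w) ! j" if "j \<in> {i<..n}" for j
      unfolding m_def using later that by (intro Min_le) auto
    have less: "m < (0 # w) ! j" if "j \<in> {i<..n}" "j \<noteq> p" for j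
      using least[OF that(1)] letter_inject[OF word_facts(1,2), of j p] that p word_facts(4) by simp
    have "(0 # w) ! i \<le> m"
      using False \<open>m \<in> set (drop i w)\<close> by auto
    then have i_less: "(0 # w) ! i < m"
      using letter_inject[OF word_facts(1,2), of i p] p word_facts(4) by (auto simp: le_less)
    have "DE_index w p = Suc i"
    proof -
      have p': "0 < p" "p \<le> length w"
        using p word_facts(4) by auto
      show ?thesis
        using p'
      proof (cases rule: DE_index_cases[OF word_facts(1,2), consumes 2, case_names descent minimum])
        case (descent j)
        then show ?thesis using less[of j] p word_facts(4) by auto
      next
        case (minimum k)
        have "\<not> k < i"
          using minimum(5)[of i] p i_less by auto
        moreover have "\<not> i < k"
          using less[of k] minimum(3,4) p by auto
        ultimately show ?thesis
          using minimum(2) by simp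
      qed
    qed
    then have "DE_place w p = (0 # w) ! Suc i"
      by (simp add: DE_place_index)
    then show ?thesis
      using False nth_DE[of p] p by (auto simp: m_def)
  qed
qed

end

lemma DE_inj_on: "inj_on DE (permutations_of_set {1..n})"
proof (rule inj_onI)
  fix w w' assume w: "w \<in> permutations_of_set {1..n}" and w': "w' \<in> permutations_of_set {1..n}"
    and eq: "DE w = DE w'"
  note p = word_facts[OF w] and p' = word_facts[OF w']
  have "take i w = take i w'" if "i \<le> n" for i
    using that
  proof (induction i)
    case (Suc i)
    then have i: "i < n" and IH: "take i w = take i w'"
      by auto
    have "set (drop i v) = set v - set (take i v)" if "distinct v" for v :: "nat list"
      using set_take_disj_set_drop_if_distinct[OF that, of i i] set_append[of "take i v" "drop i v"]
      by auto
    then have later: "set (drop i w) = set (drop i w')"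
      using p(1,3) p'(1,3) IH by simp
    have "(0 # w) ! i = (0 # w') ! i"
    proof (cases i)
      case (Suc j)
      then have "take i w ! j = take i w' ! j"
        using IH by simp
      then show ?thesis
        using Suc by simp
    qed simp
    then have same: "DE w ! (w ! i - 1) = DE w ! (w' ! i - 1)"
      using DE_next_letter[OF w i] DE_next_letter[OF w' i] later eq by simp
    have letters: "w ! i \<in> {1..n}" "w' ! i \<in> {1..n}"
      using nth_word[OF w, of "Suc i"] nth_word[OF w', of "Suc i"] i by simp_all
    have "distinct (DE w)"
      using DE_perm[OF w] by (auto dest: permutations_of_setD)
    then have "w ! i - 1 = w' ! i - 1"
      using same letters p(4) nth_eq_iff_index_eq[of "DE w" "w ! i - 1" "w' ! i - 1"] by auto
    then have "w ! i = w' ! i"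
      using letters by auto
    then show ?case
      using IH i p(4) p'(4) by (simp add: take_Suc_conv_app_nth)
  qed simp
  from this[of n] show "w = w'"
    using p(4) p'(4) by simp
qed

theorem bij_betw_DE: "bij_betw DE (permutations_of_set {1..n}) (permutations_of_set {1..n})"
  unfolding bij_betw_def
  using DE_inj_on endo_inj_surj[OF finite_permutations_of_set _ DE_inj_on] DE_perm by blast

declare nth_Cons_pos [simp]


section \<open>Left-to-right maxima\<close>

text \<open>
  The argument \<open>d\<close> is the largest letter met before the list starts.
\<close>

fun maxima :: "nat \<Rightarrow> nat list \<Rightarrow> bool list" where
  "maxima d [] = []"
| "maxima d (x # xs) = (d < x) # maxima (max d x) xs"

lemma length_maxima [simp]: "length (maxima d xs) = length xs"
  by (induction xs arbitrary: d) auto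

lemma maxima_snoc: "maxima d (xs @ [c]) = maxima d xs @ [fold max xs d < c]"
  by (induction xs arbitrary: d) (auto simp: max.commute)

text \<open>
  Adding a column with 1s in the marked rows: from right to left, the value at each marked place
  is replaced by the one carried along, initially \<open>m\<close>, and is carried further. What is left over at the
  end is the last letter of the new word.
\<close>

fun push :: "bool list \<Rightarrow> nat list \<Rightarrow> nat \<Rightarrow> nat list \<times> nat" where
  "push (b # bs) (x # xs) m =
     (case push bs xs m of (ys, c) \<Rightarrow> if b then (c # ys, x) else (x # ys, c))"
| "push _ _ m = ([], m)"

text \<open>
  The inverse of \<open>push\<close> starts with that last letter and passes through the word from left to right. It exchanges the
  carried value whenever a larger one is met.
\<close>

fun pull :: "nat \<Rightarrow> nat list \<Rightarrow> bool list \<times> nat list" where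
  "pull c [] = ([], [])"
| "pull c (x # xs) =
     (if c < x then map_prod (Cons True) (Cons c) (pull x xs)
      else map_prod (Cons False) (Cons x) (pull c xs))"

lemma push_Cons:
  "push (b # bs) (x # xs) m = (ys, c) \<longleftrightarrow>
     (\<exists>ys' c'. push bs xs m = (ys', c') \<and> (ys, c) = (if b then (c' # ys', x) else (x # ys', c')))"
  by (auto split: prod.splits)

lemma push_length: "push bs xs m = (ys, c) \<Longrightarrow> length bs = length xs \<Longrightarrow> length ys = length xs"
proof (induction bs xs arbitrary: ys c rule: list_induct2')
  case (4 b bs x xs)
  then show ?case by (fastforce simp: push_Cons split: if_splits simp del: push.simps)
qed auto

lemma push_mset:
  "push bs xs m = (ys, c) \<Longrightarrow> length bs = length xs \<Longrightarrow> add_mset c (mset ys) = add_mset m (mset xs)"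
proof (induction bs xs arbitrary: ys c rule: list_induct2')
  case (4 b bs x xs)
  then obtain ys' c' where *: "push bs xs m = (ys', c')"
      "(ys, c) = (if b then (c' # ys', x) else (x # ys', c'))"
    by (auto simp: push_Cons simp del: push.simps)
  then have IH: "add_mset c' (mset ys') = add_mset m (mset xs)"
    using 4 by simp
  show ?case
    using * IH by (cases b) (simp_all add: add_mset_commute[of _ x])
qed auto

lemma push_none: "push bs xs m = (ys, c) \<Longrightarrow> length bs = length xs \<Longrightarrow> True \<notin> set bs \<Longrightarrow> c = m"
proof (induction bs xs arbitrary: ys c rule: list_induct2')
  case (4 b bs x xs)
  then show ?case by (auto simp: push_Cons simp del: push.simps)
qed auto

text \<open>
  At each point of the word both functions carry the same value: the next marked maximum, or \<open>m\<close> if there is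
  none. It exceeds all letters before that maximum, so \<open>pull\<close> exchanges precisely at the
  marked places.
\<close>

lemma pull_push:
  assumes "push bs xs m = (ys, c)" "list_all2 (\<longrightarrow>) bs (maxima d xs)" "d < m" "\<forall>x\<in>set xs. x < m"
  shows "d < c \<and> pull c ys = (bs, xs)"
  using assms
proof (induction xs arbitrary: bs ys c d)
  case (Cons x xs)
  then obtain b bs' where bs: "bs = b # bs'" "b \<longrightarrow> d < x" "list_all2 (\<longrightarrow>) bs' (maxima (max d x) xs)"
    by (auto simp: list_all2_Cons2)
  obtain ys' c' where *: "push bs' xs m = (ys', c')"
      "(ys, c) = (if b then (c' # ys', x) else (x # ys', c'))"
    using Cons.prems(1) bs by (auto simp: push_Cons simp del: push.simps)
  have "max d x < c' \<and> pull c' ys' = (bs', xs)"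
    using Cons.IH[OF *(1) bs(3)] Cons.prems by auto
  then show ?case
    using * bs by (cases b) auto
qed auto

lemma push_pull:
  assumes "pull c ys = (bs, xs)"
  shows "push bs xs (fold max ys c) = (ys, c) \<and> length bs = length ys \<and> length xs = length ys"
  using assms
proof (induction ys arbitrary: c bs xs)
  case (Cons y ys)
  show ?case
  proof (cases "c < y")
    case True
    obtain bs' xs' where p: "pull y ys = (bs', xs')"
      by (cases "pull y ys")
    then show ?thesis
      using True Cons.prems Cons.IH[OF p] by auto
  next
    case False
    obtain bs' xs' where p: "pull c ys = (bs', xs')"
      by (cases "pull c ys")
    then show ?thesis
      using False Cons.prems Cons.IH[OF p] by (auto simp: max_def)
  qed
qed auto

lemma pull_maxima:
  assumes "pull c ys = (bs, xs)" "d < c" "c \<notin> set ys" "distinct ys"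
  shows "list_all2 (\<longrightarrow>) bs (maxima d xs)"
  using assms
proof (induction ys arbitrary: c bs xs d)
  case (Cons y ys)
  show ?case
  proof (cases "c < y")
    case True
    obtain bs' xs' where p: "pull y ys = (bs', xs')"
      by (cases "pull y ys")
    then show ?thesis
      using True Cons.prems Cons.IH[OF p, of "max d c"] by auto
  next
    case False
    obtain bs' xs' where p: "pull c ys = (bs', xs')"
      by (cases "pull c ys")
    then show ?thesis
      using False Cons.prems Cons.IH[OF p, of "max d y"] by (auto simp: max_def)
  qed
qed auto

text \<open>
  After the first marked place only marked maxima remain maxima, since
  the values at the marked places have been raised to that of the next marked maximum.
\<close>

fun surviving_maxima :: "bool list \<Rightarrow> bool list \<Rightarrow> bool list" where
  "surviving_maxima (b # bs) (u # us) = u # (if b then bs else surviving_maxima bs us)"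
| "surviving_maxima _ _ = []"

lemma length_surviving_maxima: "length bs = length us \<Longrightarrow> length (surviving_maxima bs us) = length us"
  by (induction bs us rule: list_induct2) auto

lemma nth_surviving_maxima:
  "list_all2 (\<longrightarrow>) bs us \<Longrightarrow> p < length us \<Longrightarrow>
     surviving_maxima bs us ! p \<longleftrightarrow> us ! p \<and> (bs ! p \<or> (\<forall>q<p. \<not> bs ! q))"
proof (induction arbitrary: p rule: list_all2_induct)
  case (Cons b bs u us)
  show ?case
  proof (cases p)
    case (Suc p')
    then have p': "p' < length us"
      using Cons.prems by simp
    have "bs ! p' \<longrightarrow> us ! p'"
      using list_all2_nthD2[OF Cons.hyps(2) p'] .
    then show ?thesis
      using Suc Cons.IH[OF p'] by (auto simp: All_less_Suc2 less_Suc_eq_0_disj)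
  qed simp
qed simp

lemma maxima_push:
  assumes "push bs xs m = (ys, c)" "list_all2 (\<longrightarrow>) bs (maxima d xs)" "d < m" "\<forall>x\<in>set xs. x < m"
  shows "maxima c ys = bs" "maxima d ys = surviving_maxima bs (maxima d xs)"
  using assms
proof (induction xs arbitrary: bs ys c d)
  case (Cons x xs)
  {
    case 1
    then obtain b bs' where bs: "bs = b # bs'" "b \<longrightarrow> d < x" "list_all2 (\<longrightarrow>) bs' (maxima (max d x) xs)"
      by (auto simp: list_all2_Cons2)
    obtain ys' c' where *: "push bs' xs m = (ys', c')"
        "(ys, c) = (if b then (c' # ys', x) else (x # ys', c'))"
      using 1(1) bs by (auto simp: push_Cons simp del: push.simps)
    have "d < c'" "x < c'"
      using pull_push[OF *(1) bs(3)] 1 by auto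
    moreover have "maxima c' ys' = bs'"
      using Cons.IH(1)[OF *(1) bs(3)] 1 by auto
    ultimately show ?case
      using * bs by (cases b) (auto simp: max_def)
  next
    case 2
    then obtain b bs' where bs: "bs = b # bs'" "b \<longrightarrow> d < x" "list_all2 (\<longrightarrow>) bs' (maxima (max d x) xs)"
      by (auto simp: list_all2_Cons2)
    obtain ys' c' where *: "push bs' xs m = (ys', c')"
        "(ys, c) = (if b then (c' # ys', x) else (x # ys', c'))"
      using 2(1) bs by (auto simp: push_Cons simp del: push.simps)
    have "d < c'" "x < c'"
      using pull_push[OF *(1) bs(3)] 2 by auto
    moreover have "maxima c' ys' = bs'" "maxima (max d x) ys' = surviving_maxima bs' (maxima (max d x) xs)"
      using Cons.IH[OF *(1) bs(3)] 2 by auto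
    ultimately show ?case
      using * bs by (cases b) (auto simp: max_def)
  }
qed auto

lemma push_nth:
  assumes "push bs xs m = (ys, c)" "list_all2 (\<longrightarrow>) bs (maxima d xs)" "d < m" "\<forall>x\<in>set xs. x < m"
    and "p < length xs"
  shows "if bs ! p then xs ! p < ys ! p else ys ! p = xs ! p"
  using assms
proof (induction xs arbitrary: bs ys c d p)
  case (Cons x xs)
  then obtain b bs' where bs: "bs = b # bs'" "b \<longrightarrow> d < x" "list_all2 (\<longrightarrow>) bs' (maxima (max d x) xs)"
    by (auto simp: list_all2_Cons2)
  obtain ys' c' where *: "push bs' xs m = (ys', c')"
      "(ys, c) = (if b then (c' # ys', x) else (x # ys', c'))"
    using Cons.prems(1) bs by (auto simp: push_Cons simp del: push.simps)
  have "d < c'" "x < c'"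
    using pull_push[OF *(1) bs(3)] Cons.prems by auto
  moreover have "if bs' ! p' then xs ! p' < ys' ! p' else ys' ! p' = xs ! p'" if "p = Suc p'" for p'
    using Cons.IH[OF *(1) bs(3)] Cons.prems that by auto
  ultimately show ?case
    using * bs by (cases b; cases p) auto
qed simp


section \<open>Adding a column to a Le-tableau\<close>

text \<open>
  The rows in which an entry 1 may be put into a new left column.
\<close>

definition unrestricted :: "tableau \<Rightarrow> nat \<Rightarrow> bool" where
  "unrestricted t i \<longleftrightarrow> (\<forall>j. cell t i j \<and> (\<exists>i'<i. t ! i' ! j) \<longrightarrow> t ! i ! j)"

lemma cell_add_row [simp]: "cell (t @ [[]]) i j \<longleftrightarrow> cell t i j"
  by (auto simp: cell_def row_len_def nth_append)

lemma le_tableau_add_row: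
  "le_tableau (t @ [[]]) \<longleftrightarrow> le_tableau t"
  unfolding le_tableau_def ferrers_add_row ncols_add_row cell_add_row
  by (simp add: cell_def nth_append cong: conj_cong imp_cong)

lemma unrestricted_add_row:
  "i < length t \<Longrightarrow> unrestricted (t @ [[]]) i \<longleftrightarrow> unrestricted t i" "unrestricted (t @ [[]]) (length t)"
  unfolding unrestricted_def cell_add_row
  by (simp_all add: cell_def nth_append cong: conj_cong imp_cong)

context
  fixes c :: "bool list" and t :: tableau
  assumes len: "length c = length t" and nonempty: "t \<noteq> []" and ferrers: "ferrers t"
begin

lemma cell_add_column:
  "cell (add_column c t) i 0 \<longleftrightarrow> i < length t"
  "cell (add_column c t) i (Suc j) \<longleftrightarrow> cell t i j"
  using len by (auto simp: cell_def row_len_def)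

lemma add_column_nth:
  "i < length t \<Longrightarrow> add_column c t ! i ! 0 \<longleftrightarrow> c ! i"
  "i < length t \<Longrightarrow> add_column c t ! i ! Suc j \<longleftrightarrow> t ! i ! j"
  using len by auto

lemma cell_length: "cell t i j \<Longrightarrow> i < length t"
  by (simp add: cell_def)

lemma unrestricted_add_column:
  assumes i: "i < length t"
  shows "unrestricted (add_column c t) i \<longleftrightarrow> unrestricted t i \<and> (c ! i \<or> (\<forall>i'<i. \<not> c ! i'))"
proof -
  have split: "(\<forall>j. P j) \<longleftrightarrow> P 0 \<and> (\<forall>j. P (Suc j))" for P
    by (metis not0_implies_Suc)
  have upper: "i' < length t" if "i' < i" for i'
    using that i by simp
  show ?thesis
    unfolding unrestricted_def
    by (subst split) (use i upper in \<open>auto simp add: cell_add_column len cong: conj_cong\<close>)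
qed

lemma le_tableau_add_column:
  "le_tableau (add_column c t) \<longleftrightarrow>
     le_tableau t \<and> (\<exists>i<length t. c ! i) \<and> (\<forall>i<length t. c ! i \<longrightarrow> unrestricted t i)"
proof -
  let ?T = "add_column c t"
  have "(\<forall>j<ncols ?T. \<exists>i. cell ?T i j \<and> ?T ! i ! j) \<longleftrightarrow>
      (\<exists>i<length t. c ! i) \<and> (\<forall>j<ncols t. \<exists>i. cell t i j \<and> t ! i ! j)"
    unfolding ncols_add_column[OF len nonempty] All_less_Suc2 cell_add_column
    by (simp add: cell_def len cong: conj_cong)
  moreover have "(\<forall>i j. cell ?T i j \<and> (\<exists>i'<i. ?T ! i' ! j) \<and> (\<exists>j'<j. ?T ! i ! j') \<longrightarrow> ?T ! i ! j) \<longleftrightarrow>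
      (\<forall>i j. cell t i j \<and> (\<exists>i'<i. t ! i' ! j) \<and> (\<exists>j'<j. t ! i ! j') \<longrightarrow> t ! i ! j) \<and>
      (\<forall>i<length t. c ! i \<longrightarrow> unrestricted t i)" (is "?l \<longleftrightarrow> ?r")
  proof -
    have above: "(\<exists>i'<i. ?T ! i' ! Suc j) \<longleftrightarrow> (\<exists>i'<i. t ! i' ! j)" if "cell t i j" for i j
      using cell_length[OF that] by (simp add: len cong: conj_cong)
    have left: "(\<exists>j'<Suc j. ?T ! i ! j') \<longleftrightarrow> c ! i \<or> (\<exists>j'<j. t ! i ! j')" if "cell t i j" for i j
      using cell_length[OF that] by (simp only: Ex_less_Suc2 add_column_nth)
    have "?l \<longleftrightarrow> (\<forall>i j. cell ?T i (Suc j) \<and> (\<exists>i'<i. ?T ! i' ! Suc j) \<and> (\<exists>j'<Suc j. ?T ! i ! j') \<longrightarrow>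
        ?T ! i ! Suc j)"
    proof (rule all_cong1)
      have "(\<forall>j. Q j) \<longleftrightarrow> (\<forall>j. Q (Suc j))" if "Q 0" for Q :: "nat \<Rightarrow> bool"
        using that by (metis not0_implies_Suc)
      from this[of "\<lambda>j. cell ?T i j \<and> (\<exists>i'<i. ?T ! i' ! j) \<and> (\<exists>j'<j. ?T ! i ! j') \<longrightarrow> ?T ! i ! j" for i]
      show "(\<forall>j. cell ?T i j \<and> (\<exists>i'<i. ?T ! i' ! j) \<and> (\<exists>j'<j. ?T ! i ! j') \<longrightarrow> ?T ! i ! j) \<longleftrightarrow>
        (\<forall>j. cell ?T i (Suc j) \<and> (\<exists>i'<i. ?T ! i' ! Suc j) \<and> (\<exists>j'<Suc j. ?T ! i ! j') \<longrightarrow>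
          ?T ! i ! Suc j)" for i
        by simp
    qed
    also have "\<dots> \<longleftrightarrow> (\<forall>i j. cell t i j \<and> (\<exists>i'<i. t ! i' ! j) \<and> (c ! i \<or> (\<exists>j'<j. t ! i ! j')) \<longrightarrow>
        t ! i ! j)"
      unfolding cell_add_column
      by (intro all_cong1) (use above left add_column_nth(2)[OF cell_length] in blast)
    also have "\<dots> \<longleftrightarrow> ?r"
      unfolding unrestricted_def using cell_length by blast
    finally show ?thesis .
  qed
  ultimately show ?thesis
    using ferrers ferrers_add_column[OF len] unfolding le_tableau_def by argo
qed

end


lemma push_some:
  "push bs xs m = (ys, c) \<Longrightarrow> length bs = length xs \<Longrightarrow> True \<in> set bs \<Longrightarrow> c \<in> set xs"
proof (induction bs xs arbitrary: ys c rule: list_induct2')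
  case (4 b bs x xs)
  then show ?case by (auto simp: push_Cons split: if_splits simp del: push.simps)
qed auto

section \<open>The paths of a Le-tableau\<close>

lemma exit_step_in_border:
  assumes "ferrers t" "h = Rightward \<Longrightarrow> i < nrows t" "h = Downward \<Longrightarrow> j < ncols t"
  shows "exit_step t h i j \<in> set (border t)"
  using assms
proof (induction t h i j rule: exit_step.induct)
  case (1 t h i j)
  show ?case
  proof (cases "cell t i j")
    case True
    have "i < nrows t" "j < ncols t"
      using cell_in_range[OF 1(3) True] .
    then show ?thesis
      using 1(1,2)[OF True] 1(3) True
      by (subst exit_step.simps) (cases "if t ! i ! j then turn h else h"; simp)
  next
    case False
    then show ?thesis
      using 1(3-) by (subst exit_step.simps) (cases h; simp)
  qed
qed

lemma path_exit_in_border: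
  "ferrers t \<Longrightarrow> s \<in> set (border t) \<Longrightarrow> path_exit t s \<in> set (border t)"
  by (cases s rule: line.exhaust) (auto intro!: exit_step_in_border)

lemma exit_step_add_row: "exit_step (t @ [[]]) h i j = exit_step t h i j"
proof (induction t h i j rule: exit_step.induct)
  case (1 t h i j)
  show ?case
  proof (cases "cell t i j")
    case True
    then have "(t @ [[]]) ! i = t ! i"
      by (simp add: cell_def nth_append)
    then show ?thesis
      using 1[OF True] True
      by (subst (1 2) exit_step.simps) (cases "if t ! i ! j then turn h else h"; simp)
  next
    case False
    then show ?thesis
      by (subst (1 2) exit_step.simps) simp
  qed
qed

lemma Phi_add_row:
  assumes "ferrers t"
  shows "Phi (t @ [[]]) = Phi t @ [Suc (length (border t))]"
proof -
  have path: "path_exit (t @ [[]]) s = path_exit t s" for s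
    by (cases s) (simp_all add: exit_step_add_row)
  have last: "exit_step t Rightward (length t) 0 = Row (length t)"
    by (simp add: exit_step.simps cell_def)
  have "Row (length t) \<notin> set (border t)"
    using assms by (simp add: nrows_def)
  then show ?thesis
    using assms path_exit_in_border[OF assms]
    by (simp add: Phi_def border_add_row path last le_label_def ew_label_pos pos_append)
qed

definition row_vector :: "tableau \<Rightarrow> (nat \<Rightarrow> bool) \<Rightarrow> bool list" where
  "row_vector t P = map (\<lambda>s. case s of Row i \<Rightarrow> P i | Col j \<Rightarrow> False) (border t)"

lemma filter_rows_border:
  assumes "ferrers t"
  shows "filter is_row (border t) = map Row [0..<nrows t]"
  using assms
proof (induction rule: ferrers_induct)
  case (row t)
  then show ?case by (simp add: border_add_row nrows_def)
next
  case (column c t)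
  have "filter is_row (map move_right xs) = map move_right (filter is_row xs)" for xs
    by (induction xs) auto
  then show ?case
    using column by (simp add: border_add_column comp_def)
qed (simp add: nrows_def)

context
  fixes c :: "bool list" and t :: tableau
  assumes len: "length c = length t" and nonempty: "t \<noteq> []" and ferrers: "ferrers t"
begin

abbreviation wider where "wider \<equiv> add_column c t"

lemmas cell_wider = cell_add_column[OF len nonempty ferrers]
lemmas wider_nth = add_column_nth[OF len nonempty ferrers]
lemmas border_wider = border_add_column[OF len nonempty]

lemma exit_step_move_right:
  "exit_step wider h i (Suc j) = move_right (exit_step t h i j)"
proof -
  have "s = t \<Longrightarrow> exit_step wider h i (Suc j) = move_right (exit_step s h i j)" for s
  proof (induction s h i j rule: exit_step.induct)
    case (1 s h i j)
    show ?case
    proof (cases "cell t i j")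
      case True
      then have "wider ! i ! Suc j \<longleftrightarrow> t ! i ! j"
        using wider_nth(2) by (simp add: cell_def)
      then show ?thesis
        using 1 True cell_wider(2)
        by (subst (1 2) exit_step.simps) (cases "if t ! i ! j then turn h else h"; simp)
    next
      case False
      then show ?thesis
        using 1(3) cell_wider(2) by (subst (1 2) exit_step.simps) (cases h; simp)
    qed
  qed
  then show ?thesis
    by simp
qed

lemma exit_down_first_column:
  "exit_step wider Downward i 0 =
     (if i < length t
      then if c ! i then move_right (exit_step t Rightward i 0) else exit_step wider Downward (Suc i) 0
      else Col 0)"
  using cell_wider(1)[of i] wider_nth(1)[of i] exit_step_move_right[of Rightward i 0]
  by (subst exit_step.simps) simp

lemma exit_right_first_column:
  "i < length t \<Longrightarrow> exit_step wider Rightward i 0 =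
     (if c ! i then exit_step wider Downward (Suc i) 0 else move_right (exit_step t Rightward i 0))"
  using cell_wider(1)[of i] wider_nth(1)[of i] exit_step_move_right[of Rightward i 0]
  by (subst exit_step.simps) simp

lemma le_label_move_right:
  "s \<in> set (border t) \<Longrightarrow> le_label wider (move_right s) = le_label t s"
  by (simp add: le_label_def ew_label_pos border_wider pos_append pos_map_inj[OF inj_move_right])

lemma le_label_first_column: "le_label wider (Col 0) = Suc (length (border t))"
proof -
  have "Col 0 \<noteq> move_right s" for s
    by (cases s) auto
  then have "Col 0 \<notin> set (map move_right (border t))"
    by auto
  then show ?thesis
    by (simp add: le_label_def ew_label_pos border_wider pos_append)
qed

text \<open>
  Entering the new column in row \<open>i\<close> from above, a path turns right at the next 1 and continues as the
  old path of that row; without a further 1 it leaves through the bottom of the column. The label of its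
  exit is the value that \<open>push\<close> carries.
\<close>

lemma push_border:
  assumes "filter is_row zs = map Row [i..<length t]" "i \<le> length t" "set zs \<subseteq> set (border t)"
  shows "push (map (\<lambda>s. case s of Row i \<Rightarrow> c ! i | Col j \<Rightarrow> False) zs)
      (map (\<lambda>s. le_label t (path_exit t s)) zs) (Suc (length (border t))) =
    (map (\<lambda>s. le_label wider (path_exit wider (move_right s))) zs, le_label wider (exit_step wider Downward i 0))"
  using assms
proof (induction zs arbitrary: i)
  case Nil
  then have "i = length t"
    by auto
  then show ?case
    by (simp add: exit_down_first_column le_label_first_column)
next
  case (Cons s zs)
  have in_border: "path_exit t s \<in> set (border t)"
    using Cons.prems path_exit_in_border[OF ferrers] by simp
  show ?case
  proof (cases s rule: line.exhaust)
    case (Row k)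
    have "[i..<length t] \<noteq> []"
      using Cons.prems(1) Row by auto
    then have i: "i < length t"
      by simp
    then have "k = i" "filter is_row zs = map Row [Suc i..<length t]"
      using Cons.prems(1) Row by (auto simp: upt_conv_Cons)
    then show ?thesis
      using Cons.IH[of "Suc i"] Cons.prems(3) i Row in_border
      by (simp add: exit_down_first_column[of i] exit_right_first_column le_label_move_right)
  next
    case (Col j)
    then show ?thesis
      using Cons in_border by (simp add: exit_step_move_right le_label_move_right)
  qed
qed

lemma Phi_add_column:
  obtains ys x where "push (row_vector t ((!) c)) (Phi t) (Suc (length (border t))) = (ys, x)"
    "Phi wider = ys @ [x]"
proof
  show "push (row_vector t ((!) c)) (Phi t) (Suc (length (border t))) =
    (map (\<lambda>s. le_label wider (path_exit wider (move_right s))) (border t), le_label wider (exit_step wider Downward 0 0))"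
    unfolding row_vector_def Phi_def
    using filter_rows_border[OF ferrers] by (intro push_border) (simp_all add: nrows_def)
  show "Phi wider = map (\<lambda>s. le_label wider (path_exit wider (move_right s))) (border t) @
      [le_label wider (exit_step wider Downward 0 0)]"
    by (simp add: Phi_def border_wider)
qed

lemma row_vector_add_column: "row_vector wider P = row_vector t P @ [False]"
proof -
  have "(case move_right s of Row i \<Rightarrow> P i | Col j \<Rightarrow> False) = (case s of Row i \<Rightarrow> P i | Col j \<Rightarrow> False)" for s
    by (cases s) auto
  then show ?thesis
    by (simp add: row_vector_def border_wider)
qed

end

lemma length_row_vector [simp]: "ferrers t \<Longrightarrow> length (row_vector t P) = nrows t + ncols t"
  by (simp add: row_vector_def length_border)

lemma nth_row_vector:
  "p < length (border t) \<Longrightarrow>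
     row_vector t P ! p \<longleftrightarrow> (\<exists>i. border t ! p = Row i \<and> P i)"
  by (auto simp: row_vector_def split: line.splits)

lemma row_vector_label:
  "ferrers t \<Longrightarrow> i < nrows t \<Longrightarrow> row_vector t P ! ew_label t (Row i) \<longleftrightarrow> P i"
  using nth_row_vector[of "ew_label t (Row i)" t P]
  by (simp add: ew_label_pos)

lemma row_vector_cong:
  assumes "ferrers t" "\<And>i. i < nrows t \<Longrightarrow> P i = Q i"
  shows "row_vector t P = row_vector t Q"
  unfolding row_vector_def
proof (rule map_cong[OF refl])
  fix s assume "s \<in> set (border t)"
  then show "(case s of Row i \<Rightarrow> P i | Col j \<Rightarrow> False) = (case s of Row i \<Rightarrow> Q i | Col j \<Rightarrow> False)"
    using assms by (cases s rule: line.exhaust) auto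
qed

lemma list_all2_row_vector:
  "ferrers t \<Longrightarrow> list_all2 (\<longrightarrow>) (row_vector t P) (row_vector t Q) \<longleftrightarrow> (\<forall>i<nrows t. P i \<longrightarrow> Q i)"
  (is "_ \<Longrightarrow> ?l \<longleftrightarrow> ?r")
proof (intro iffI allI impI)
  fix i assume "ferrers t" ?l "i < nrows t" "P i"
  then have "ew_label t (Row i) < length (row_vector t P)"
    by (simp add: row_vector_def ew_label_pos)
  from list_all2_nthD[OF \<open>?l\<close> this] show "Q i"
    using \<open>ferrers t\<close> \<open>i < nrows t\<close> \<open>P i\<close> by (simp add: row_vector_label)
next
  assume "ferrers t" ?r
  then show ?l
    unfolding row_vector_def
    by (auto simp: list_all2_map1 list_all2_map2 list_all2_same split: line.splits)
qed

lemma True_in_row_vector: "ferrers t \<Longrightarrow> True \<in> set (row_vector t P) \<longleftrightarrow> (\<exists>i<nrows t. P i)"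
  by (auto simp: row_vector_def set_border split: line.splits)

lemma surviving_maxima_row_vector:
  assumes t: "ferrers t" and PQ: "\<And>i. i < nrows t \<Longrightarrow> P i \<Longrightarrow> Q i"
  shows "surviving_maxima (row_vector t P) (row_vector t Q) =
    row_vector t (\<lambda>i. Q i \<and> (P i \<or> (\<forall>i'<i. \<not> P i')))"
proof (rule nth_equalityI)
  show "length (surviving_maxima (row_vector t P) (row_vector t Q)) =
      length (row_vector t (\<lambda>i. Q i \<and> (P i \<or> (\<forall>i'<i. \<not> P i'))))"
    using t by (simp add: length_surviving_maxima)
next
  fix p assume "p < length (surviving_maxima (row_vector t P) (row_vector t Q))"
  then have p: "p < length (border t)" "p < length (row_vector t Q)"
    using t by (simp_all add: length_surviving_maxima length_border)
  have all: "list_all2 (\<longrightarrow>) (row_vector t P) (row_vector t Q)"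
    using PQ t list_all2_row_vector by blast
  show "surviving_maxima (row_vector t P) (row_vector t Q) ! p =
      row_vector t (\<lambda>i. Q i \<and> (P i \<or> (\<forall>i'<i. \<not> P i'))) ! p"
  proof (cases "border t ! p" rule: line.exhaust)
    case (Row i)
    then have "Row i \<in> set (border t)"
      using p(1) nth_mem by fastforce
    then have i: "i < nrows t" "p = ew_label t (Row i)"
      using t Row p ew_label_nth_border[of t p] by (auto simp: length_border)
    have "(\<forall>q<p. \<not> row_vector t P ! q) \<longleftrightarrow> (\<forall>i'<i. \<not> P i')"
    proof safe
      fix i' assume none: "\<forall>q<p. \<not> row_vector t P ! q" and i': "i' < i" "P i'"
      then have "ew_label t (Row i') < p"
        using i t by (simp add: label_less_iff)
      then show False
        using none i' i row_vector_label[OF t, of i' P] by auto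
    next
      fix q assume none: "\<forall>i'<i. \<not> P i'" and q: "q < p" "row_vector t P ! q"
      then obtain i' where "border t ! q = Row i'" "P i'"
        using nth_row_vector[of q t P] p(1) by auto
      then show False
        using none sorted_wrt_nth_less[OF sorted_border[OF t] q(1) p(1)] Row by simp
    qed
    then show ?thesis
      unfolding nth_surviving_maxima[OF all p(2)] nth_row_vector[OF p(1)] using Row by auto
  next
    case (Col j)
    then show ?thesis
      unfolding nth_surviving_maxima[OF all p(2)] nth_row_vector[OF p(1)] by auto
  qed
qed

section \<open>The map Phi is a bijection\<close>

lemma Le_0: "Le 0 = {[]}"
  by (auto simp: Le_def le_tableau_def nrows_def ncols_def ferrers_def shape_def row_len_def cell_def)

lemma LeD:
  assumes "t \<in> Le n"
  shows "ferrers t" "le_tableau t" "nrows t + ncols t = n" "length (border t) = n"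
proof -
  show "le_tableau t" "nrows t + ncols t = n"
    using assms by (simp_all add: Le_def)
  then show "ferrers t"
    by (simp add: le_tableau_def)
  then show "length (border t) = n"
    using \<open>nrows t + ncols t = n\<close> by (simp add: length_border)
qed

lemma Le_add_row: "t @ [[]] \<in> Le (Suc n) \<longleftrightarrow> t \<in> Le n"
  by (simp add: Le_def le_tableau_add_row)

definition admissible_column :: "bool list \<Rightarrow> tableau \<Rightarrow> bool" where
  "admissible_column c t \<longleftrightarrow> length c = length t \<and> (\<exists>i<length t. c ! i) \<and>
     (\<forall>i<length t. c ! i \<longrightarrow> unrestricted t i)"

lemma admissible_column_nonempty: "admissible_column c t \<Longrightarrow> t \<noteq> []"
  by (auto simp: admissible_column_def)

lemma Le_add_column:
  assumes "length c = length t" "t \<noteq> []" "ferrers t"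
  shows "add_column c t \<in> Le (Suc n) \<longleftrightarrow> t \<in> Le n \<and> admissible_column c t"
  unfolding Le_def mem_Collect_eq le_tableau_add_column[OF assms] ncols_add_column[OF assms(1,2)]
    nrows_add_column[OF assms(1)] admissible_column_def
  using assms(1) by auto

lemma Le_Suc_cases:
  assumes "t \<in> Le (Suc n)"
  obtains (row) t' where "t' \<in> Le n" "t = t' @ [[]]"
    | (column) c t' where "t' \<in> Le n" "admissible_column c t'" "t = add_column c t'"
  using LeD(1)[OF assms]
proof (cases rule: ferrers_cases)
  case Nil
  then show ?thesis
    using LeD(3)[OF assms] by (simp add: nrows_def ncols_def row_len_def)
next
  case (row t')
  then show ?thesis
    using that(1) assms Le_add_row by blast
next
  case (column c t')
  then show ?thesis
    using that(2) assms Le_add_column[OF column(3,2,1)] by blast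
qed

text \<open>
  The properties of \<open>\<Phi>\<close> that are carried through the induction. Place \<open>p\<close> of the list
  stands for the label \<open>p + 1\<close>, so the last clause identifies the rows with the weak excedances.
\<close>

definition word_profile :: "nat \<Rightarrow> tableau \<Rightarrow> bool" where
  "word_profile n t \<longleftrightarrow> Phi t \<in> permutations_of_set {1..n} \<and>
     maxima 0 (Phi t) = row_vector t (unrestricted t) \<and>
     (\<forall>p<n. row_steps t ! p \<longleftrightarrow> p < Phi t ! p)"

lemma perm_mset_iff: "w \<in> permutations_of_set {1..n} \<longleftrightarrow> mset w = mset [1..<Suc n]"
proof
  assume "w \<in> permutations_of_set {1..n}"
  then show "mset w = mset [1..<Suc n]"
    by (intro set_eq_iff_mset_eq_distinct[THEN iffD1]) (auto dest: permutations_of_setD)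
next
  assume *: "mset w = mset [1..<Suc n]"
  show "w \<in> permutations_of_set {1..n}"
  proof
    show "set w = {1..n}"
      using mset_eq_setD[OF *] by (simp only: set_upt atLeastLessThanSuc_atLeastAtMost)
    show "distinct w"
      using mset_eq_imp_distinct_iff[OF *] by (simp only: distinct_upt)
  qed
qed

lemma word_profile_add_row:
  assumes t: "t \<in> Le n" "word_profile n t"
  shows "word_profile (Suc n) (t @ [[]])" "Phi (t @ [[]]) = Phi t @ [Suc n]"
proof -
  note f = LeD[OF t(1)]
  have length: "length (Phi t) = n"
    using f by (simp add: Phi_def)
  show Phi: "Phi (t @ [[]]) = Phi t @ [Suc n]"
    using Phi_add_row[OF f(1)] f(4) by simp
  have perm: "Phi t \<in> permutations_of_set {1..n}"
    using t(2) by (simp add: word_profile_def)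
  then have "Phi (t @ [[]]) \<in> permutations_of_set {1..Suc n}"
    unfolding Phi perm_mset_iff by simp
  moreover have "Max (set (0 # Phi t)) < Suc n"
    using permutations_of_setD(1)[OF perm] by (subst Max_less_iff) auto
  then have "fold max (Phi t) 0 < Suc n"
    by (simp only: Max.set_eq_fold)
  then have "maxima 0 (Phi (t @ [[]])) = row_vector (t @ [[]]) (unrestricted (t @ [[]]))"
    using t(2) row_vector_cong[OF f(1), of "unrestricted t" "unrestricted (t @ [[]])"]
      unrestricted_add_row(1)[of _ t] unrestricted_add_row(2)[of t]
    by (simp add: Phi maxima_snoc word_profile_def row_vector_def border_add_row nrows_def)
  moreover have "\<forall>p<Suc n. row_steps (t @ [[]]) ! p \<longleftrightarrow> p < Phi (t @ [[]]) ! p"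
    using t(2) f(4) length by (auto simp: Phi word_profile_def nth_append row_steps_def less_Suc_eq border_add_row)
  ultimately show "word_profile (Suc n) (t @ [[]])"
    by (simp add: word_profile_def)
qed

lemma word_profile_add_column:
  assumes t: "t \<in> Le n" "word_profile n t" and c: "admissible_column c t"
  obtains ys x where "push (row_vector t ((!) c)) (Phi t) (Suc n) = (ys, x)"
    "Phi (add_column c t) = ys @ [x]" "pull x ys = (row_vector t ((!) c), Phi t)" "x < Suc n"
    "word_profile (Suc n) (add_column c t)"
proof -
  note f = LeD[OF t(1)]
  have len: "length c = length t" and nonempty: "t \<noteq> []"
    using c admissible_column_nonempty by (auto simp: admissible_column_def)
  obtain ys x where push: "push (row_vector t ((!) c)) (Phi t) (Suc n) = (ys, x)"
    and Phi: "Phi (add_column c t) = ys @ [x]"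
    using Phi_add_column[OF len nonempty f(1)] f(4) by metis
  have length: "length (Phi t) = n"
    using f by (simp add: Phi_def)
  have perm: "Phi t \<in> permutations_of_set {1..n}"
    and max: "maxima 0 (Phi t) = row_vector t (unrestricted t)"
    and exc: "\<And>p. p < n \<Longrightarrow> row_steps t ! p \<longleftrightarrow> p < Phi t ! p"
    using t(2) by (simp_all add: word_profile_def)
  have small: "\<forall>x\<in>set (Phi t). x < Suc n"
    using permutations_of_setD(1)[OF perm] by auto
  have sub: "list_all2 (\<longrightarrow>) (row_vector t ((!) c)) (maxima 0 (Phi t))"
    unfolding max list_all2_row_vector[OF f(1)] using c by (auto simp: admissible_column_def nrows_def)
  have some: "True \<in> set (row_vector t ((!) c))"
    unfolding True_in_row_vector[OF f(1)] using c by (auto simp: admissible_column_def nrows_def)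
  have x: "x < Suc n"
    using push_some[OF push _ some] small f length by auto
  have pull: "0 < x" "pull x ys = (row_vector t ((!) c), Phi t)"
    using pull_push[OF push sub] small by auto
  have mset: "add_mset x (mset ys) = add_mset (Suc n) (mset (Phi t))"
    using push_mset[OF push] f length by simp
  have ys_length: "length ys = n"
    using push_length[OF push] f length by simp
  have "Suc n \<in># add_mset x (mset ys)"
    using mset by simp
  then have "Suc n \<in> set ys"
    using x by auto
  then have "Suc n \<le> fold max ys 0"
    using Max.set_eq_fold[of 0 ys] by (metis List.finite_set Max_ge list.set_intros(2))
  then have "maxima 0 (ys @ [x]) = surviving_maxima (row_vector t ((!) c)) (row_vector t (unrestricted t)) @ [False]"
    using maxima_push(2)[OF push sub] small x max by (simp add: maxima_snoc)
  also have "\<dots> = row_vector t (unrestricted (add_column c t)) @ [False]"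
    using c surviving_maxima_row_vector[OF f(1), of "(!) c" "unrestricted t"]
      row_vector_cong[OF f(1), of "unrestricted (add_column c t)"
        "\<lambda>i. unrestricted t i \<and> (c ! i \<or> (\<forall>i'<i. \<not> c ! i'))"]
      unrestricted_add_column[OF len nonempty f(1)]
    by (simp add: admissible_column_def nrows_def)
  finally have max': "maxima 0 (ys @ [x]) = row_vector (add_column c t) (unrestricted (add_column c t))"
    by (simp add: row_vector_add_column[OF len nonempty f(1)])
  have steps_length: "length (row_steps t) = n"
    using f(4) by (simp add: row_steps_def)
  have "row_steps (add_column c t) ! p \<longleftrightarrow> p < (ys @ [x]) ! p" if "p < Suc n" for p
  proof (cases "p = n")
    case True
    then show ?thesis
      using x ys_length f(4) by (simp add: row_steps_add_column[OF len nonempty] nth_append steps_length)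
  next
    case False
    then have p: "p < n"
      using that by simp
    have "row_vector t ((!) c) ! p \<longrightarrow> row_steps t ! p"
      using p f(4) nth_row_vector[of p t] by (auto simp: row_steps_def)
    moreover have "if row_vector t ((!) c) ! p then Phi t ! p < ys ! p else ys ! p = Phi t ! p"
      using push_nth[OF push sub] small p length by auto
    ultimately have "row_steps t ! p \<longleftrightarrow> p < ys ! p"
      using exc[OF p] by (auto split: if_splits)
    then show ?thesis
      using p ys_length f(4) by (simp add: row_steps_add_column[OF len nonempty] nth_append steps_length)
  qed
  moreover have "ys @ [x] \<in> permutations_of_set {1..Suc n}"
    using mset perm unfolding perm_mset_iff by simp
  ultimately have "word_profile (Suc n) (add_column c t)"
    using max' by (simp add: word_profile_def Phi)
  then show ?thesis
    using that push Phi pull x by blast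
qed

lemma Le_word_profile: "t \<in> Le n \<Longrightarrow> word_profile n t"
proof (induction n arbitrary: t)
  case 0
  then show ?case by (simp add: Le_0 word_profile_def Phi_def row_vector_def)
next
  case (Suc n)
  from Suc.prems show ?case
  proof (cases rule: Le_Suc_cases)
    case (row t')
    then show ?thesis using word_profile_add_row Suc.IH by blast
  next
    case (column c t')
    then show ?thesis using word_profile_add_column Suc.IH by metis
  qed
qed

lemma Phi_inj_on: "inj_on Phi (Le n)"
proof (induction n)
  case (Suc n)
  show ?case
  proof (rule inj_onI)
    fix t1 t2 assume t: "t1 \<in> Le (Suc n)" "t2 \<in> Le (Suc n)" and eq: "Phi t1 = Phi t2"
    have mixed: False if "s \<in> Le n" "s' \<in> Le n" "admissible_column c s'" "Phi (s @ [[]]) = Phi (add_column c s')"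
      for s s' c
      using that word_profile_add_row(2)[OF that(1) Le_word_profile[OF that(1)]]
        word_profile_add_column[OF that(2) Le_word_profile[OF that(2)] that(3)] by (metis less_irrefl snoc_eq_iff_butlast last_snoc)
    show "t1 = t2"
      using t(1)
    proof (cases rule: Le_Suc_cases)
      case r1: (row s1)
      show ?thesis
        using t(2)
      proof (cases rule: Le_Suc_cases)
        case (row s2)
        then have "Phi s1 = Phi s2"
          using eq r1 word_profile_add_row(2)[OF _ Le_word_profile] by simp
        then show ?thesis
          using Suc.IH r1 row by (simp add: inj_onD)
      qed (use mixed eq r1 in blast)
    next
      case c1: (column c1 s1)
      show ?thesis
        using t(2)
      proof (cases rule: Le_Suc_cases)
        case (column c2 s2)
        obtain ys1 x1 where 1: "Phi t1 = ys1 @ [x1]" "pull x1 ys1 = (row_vector s1 ((!) c1), Phi s1)"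
          using word_profile_add_column[OF c1(1) Le_word_profile[OF c1(1)] c1(2)] c1(3) by metis
        obtain ys2 x2 where 2: "Phi t2 = ys2 @ [x2]" "pull x2 ys2 = (row_vector s2 ((!) c2), Phi s2)"
          using word_profile_add_column[OF column(1) Le_word_profile[OF column(1)] column(2)] column(3) by metis
        have *: "row_vector s1 ((!) c1) = row_vector s2 ((!) c2)" "Phi s1 = Phi s2"
          using 1 2 eq by auto
        then have s: "s1 = s2"
          using Suc.IH c1(1) column(1) by (simp add: inj_onD)
        have "c1 = c2"
        proof (rule nth_equalityI)
          show "length c1 = length c2"
            using c1(2) column(2) s by (simp add: admissible_column_def)
          fix i assume "i < length c1"
          then have "i < nrows s1"
            using c1(2) by (simp add: admissible_column_def nrows_def)
          then show "c1 ! i = c2 ! i"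
            using row_vector_label[OF LeD(1)[OF c1(1)]] *(1) s by metis
        qed
        then show ?thesis
          using s c1 column by simp
      qed (use mixed eq[symmetric] c1 in blast)
    qed
  qed
qed (simp add: Le_0)

text \<open>
  The last letter decides which kind of tableau to look for: it is \<open>n + 1\<close> exactly if the bottom row is empty.
\<close>

lemma Phi_surj: "w \<in> permutations_of_set {1..n} \<Longrightarrow> \<exists>t\<in>Le n. Phi t = w"
proof (induction n arbitrary: w)
  case 0
  then show ?case by (simp add: Le_0 Phi_def)
next
  case (Suc n)
  have w: "set w = {1..Suc n}" "distinct w"
    using permutations_of_setD[OF Suc.prems] by auto
  then obtain ys c where ys: "w = ys @ [c]"
    by (cases w rule: rev_cases) auto
  have mset: "add_mset c (mset ys) = add_mset (Suc n) (mset [1..<Suc n])"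
    using Suc.prems unfolding perm_mset_iff ys by simp
  show ?case
  proof (cases "c = Suc n")
    case True
    then have "ys \<in> permutations_of_set {1..n}"
      using mset unfolding perm_mset_iff by simp
    then obtain t where "t \<in> Le n" "Phi t = ys"
      using Suc.IH by blast
    then show ?thesis
      using True ys word_profile_add_row(2)[OF _ Le_word_profile] Le_add_row by metis
  next
    case False
    obtain bs xs where pull: "pull c ys = (bs, xs)"
      by (cases "pull c ys")
    have letters: "set (ys @ [c]) = {1..Suc n}"
      using w(1) ys by simp
    then have "Suc n \<in> set (ys @ [c])" "c \<in> {1..Suc n}" "set ys \<subseteq> {1..Suc n}"
      by (simp, auto)
    then have "Suc n \<in> set ys" "\<forall>y\<in>set ys. y \<le> Suc n" "c \<le> Suc n" "0 < c"
      using False by auto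
    then have "fold max ys c = Suc n"
      using Max.set_eq_fold[of c ys] Max_eqI[of "set (c # ys)" "Suc n"] by auto
    then have push: "push bs xs (Suc n) = (ys, c)" "length bs = length xs" "length xs = length ys"
      using push_pull[OF pull] by auto
    have "add_mset (Suc n) (mset xs) = add_mset (Suc n) (mset [1..<Suc n])"
      using push_mset[OF push(1,2)] mset by simp
    then have xs: "xs \<in> permutations_of_set {1..n}"
      unfolding perm_mset_iff by simp
    then obtain t where t: "t \<in> Le n" "Phi t = xs"
      using Suc.IH by blast
    note f = LeD[OF t(1)]
    have "list_all2 (\<longrightarrow>) bs (maxima 0 xs)"
      using pull_maxima[OF pull \<open>0 < c\<close>] w(2) ys by simp
    then have sub: "list_all2 (\<longrightarrow>) bs (row_vector t (unrestricted t))"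
      using Le_word_profile[OF t(1)] t(2) by (simp add: word_profile_def)
    have bs_length: "length bs = n"
      using list_all2_lengthD[OF sub] f by simp
    have "True \<in> set bs"
      using push_none[OF push(1,2)] False by blast
    define col where "col = map (\<lambda>i. bs ! ew_label t (Row i)) [0..<length t]"
    have bs: "row_vector t ((!) col) = bs"
    proof (rule nth_equalityI)
      show "length (row_vector t ((!) col)) = length bs"
        using f bs_length by simp
      fix p assume "p < length (row_vector t ((!) col))"
      then have p: "p < length (border t)" "p < length bs"
        using f bs_length by simp_all
      have label: "ew_label t (border t ! p) = p"
        using p f ew_label_nth_border by simp
      show "row_vector t ((!) col) ! p = bs ! p"
      proof (cases "border t ! p" rule: line.exhaust)
        case (Row i)
        then have "i < length t"
          using nth_mem[OF p(1)] f(1) by (simp add: nrows_def)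
        then show ?thesis
          using Row label by (simp add: nth_row_vector[OF p(1)] col_def)
      next
        case (Col j)
        have "bs ! p \<longrightarrow> row_vector t (unrestricted t) ! p"
          using list_all2_nthD[OF sub p(2)] .
        then show ?thesis
          using Col by (simp add: nth_row_vector[OF p(1)])
      qed
    qed
    have "admissible_column col t"
      using sub \<open>True \<in> set bs\<close> unfolding bs[symmetric] list_all2_row_vector[OF f(1)]
        True_in_row_vector[OF f(1)] by (simp add: admissible_column_def nrows_def col_def)
    moreover have "Phi (add_column col t) = w"
      using word_profile_add_column[OF t(1) Le_word_profile[OF t(1)] \<open>admissible_column col t\<close>] push(1) t(2) ys bs
      by (metis prod.inject)
    ultimately show ?thesis
      using Le_add_column[of col t] admissible_column_nonempty t(1) f(1) by (auto simp: admissible_column_def)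
  qed
qed

theorem bij_betw_Phi: "bij_betw Phi (Le n) (permutations_of_set {1..n})"
  unfolding bij_betw_def
proof
  show "Phi ` Le n = permutations_of_set {1..n}"
    using Le_word_profile[unfolded word_profile_def] Phi_surj by blast
qed (rule Phi_inj_on)


section \<open>The composition Delta\<close>

lemma bij_betw_cyclic_shift:
  assumes "1 \<le> n"
  shows "bij_betw cyclic_shift (permutations_of_set {1..n}) (permutations_of_set {1..n})"
proof -
  let ?S = "permutations_of_set {1..n}"
  have nonempty: "w \<noteq> []" if "w \<in> ?S" for w
    using permutations_of_setD(1)[OF that] assms by auto
  have inj: "inj_on cyclic_shift ?S"
    by (rule inj_onI) (metis append_butlast_last_id cyclic_shift_def list.inject nonempty)
  have "cyclic_shift w \<in> ?S" if "w \<in> ?S" for w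
  proof -
    have "w = butlast w @ [last w]"
      using nonempty[OF that] by simp
    then have "mset (cyclic_shift w) = mset w"
      by (metis cyclic_shift_def mset.simps(2) mset_append union_mset_add_mset_right add.right_neutral mset.simps(1))
    then show ?thesis
      using that unfolding perm_mset_iff by simp
  qed
  then show ?thesis
    unfolding bij_betw_def using inj endo_inj_surj[OF finite_permutations_of_set _ inj] by blast
qed

text \<open>
  At label 0 of \<open>E\<close>, that is, at place 1 of the shifted word, both tableaux have a row: the top row
  of \<open>E\<close>, and a row of \<open>L\<close> because every letter is at least 1. The last label \<open>n\<close> of \<open>E\<close> belongs to a column,
  as \<open>n\<close> is no descent bottom.
\<close>

lemma shape_of_Delta:
  assumes n: "1 \<le> n" and E: "E \<in> EW n" and L: "L \<in> Le n" and eq: "Phi L = cyclic_shift (DE (Psi E))"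
  shows "shape E = add_left_column (shape L)"
proof -
  define w where "w = Psi E"
  note E' = EW_size[OF E]
  have reads: "reads E w"
    unfolding w_def using E'(1) by (rule reads_Psi)
  then have w: "w \<in> permutations_of_set {1..n}"
    using E'(3) by (simp add: reads_def)
  have b: "set (DE w) = {1..n}" "length (DE w) = n"
    using permutations_of_setD(1)[OF DE_perm[OF w]] word_facts(4)[OF w] by simp_all
  have "DE w \<noteq> []"
    using length_DE[of w] word_facts(4)[OF w] n by force
  have E_steps: "row_steps E = map (\<lambda>x. x = 0 \<or> x \<in> descent_bottoms w) [0..<Suc n]"
    using reads_row_steps[OF E'(1) reads] E'(2) by simp
  have L_steps: "row_steps L ! p \<longleftrightarrow> p < (last (DE w) # butlast (DE w)) ! p" if "p < n" for p
    using Le_word_profile[OF L] that eq by (simp add: word_profile_def cyclic_shift_def w_def)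
  have L_length: "length (row_steps L) = n"
    using LeD(4)[OF L] by (simp add: row_steps_def)
  have same: "row_steps L ! p \<longleftrightarrow> p = 0 \<or> p \<in> descent_bottoms w" if p: "p < n" for p
  proof (cases p)
    case 0
    have "last (DE w) \<in> {1..n}"
      using b(1) \<open>DE w \<noteq> []\<close> last_in_set by blast
    then show ?thesis
      using L_steps[OF p] 0 by simp
  next
    case (Suc q)
    then have "row_steps L ! p \<longleftrightarrow> p < DE w ! (p - 1)"
      using L_steps[OF p] p b(2) by (simp add: nth_butlast)
    then show ?thesis
      using DE_excedance_iff[OF w, of p] p Suc by simp
  qed
  have "DE w ! (n - 1) \<in> {1..n}"
    using b n nth_mem[of "n - 1" "DE w"] by simp
  then have "n \<notin> descent_bottoms w"
    using DE_excedance_iff[OF w, of n] n by auto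
  then have "row_steps E = row_steps L @ [False]"
    unfolding E_steps using same L_length n
    by (intro nth_equalityI) (auto simp: nth_append less_Suc_eq simp del: upt_Suc)
  then show ?thesis
    using shape_eq_shape_of_steps[OF ew_ferrers[OF E'(1)]] shape_eq_shape_of_steps[OF LeD(1)[OF L]]
    by (simp add: shape_of_steps_snoc add_left_column_def)
qed

theorem mainTheorem3:
  fixes n :: nat
  assumes "n \<ge> 1"
  shows "bij_betw (Delta n) (EW n) (Le n) \<and>
         (\<forall>E \<in> EW n. shape E = add_left_column (shape (Delta n E)))"
proof
  have inverse: "bij_betw (inv_into (Le n) Phi) (permutations_of_set {1..n}) (Le n)"
    by (rule bij_betw_inv_into[OF bij_betw_Phi])
  show bij: "bij_betw (Delta n) (EW n) (Le n)"
    unfolding Delta_def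
    using bij_betw_trans[OF bij_betw_trans[OF bij_betw_trans[OF bij_betw_Psi[OF assms] bij_betw_DE]
      bij_betw_cyclic_shift[OF assms]] inverse]
    by (simp add: comp_assoc)
  show "\<forall>E\<in>EW n. shape E = add_left_column (shape (Delta n E))"
  proof
    fix E assume E: "E \<in> EW n"
    have "cyclic_shift (DE (Psi E)) \<in> permutations_of_set {1..n}"
      using E bij_betw_Psi[OF assms] bij_betw_DE[of n] bij_betw_cyclic_shift[OF assms]
      by (blast dest: bij_betwE)
    then have "Phi (Delta n E) = cyclic_shift (DE (Psi E))"
      using bij_betw_inv_into_right[OF bij_betw_Phi] by (simp add: Delta_def)
    then show "shape E = add_left_column (shape (Delta n E))"
      using shape_of_Delta[OF assms E] bij_betwE[OF bij] E by blast
  qed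
qed

end
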